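(* Suppose that there is a spatially independent branching mechanism $$\psi(\lambda)=-b\lambda+a\lambda^2+\int_{(0,\infty)}(e^{-\lambda y}-1+\lambda y)\,\eta(dy),\qquad\lambda\ge0,$$ with $b\in\mathbb{R}$, $a\ge 0$ and $\eta$ a measure on $(0,\infty)$ satisfying $\int_{(0,\infty)}(y\wedge y^2)\eta(dy)<\infty$, such that $\psi(\infty)=\infty$, $\int^\infty\psi(\lambda)^{-1}d\lambda<\infty$ (i.e. $\int_N^\infty\psi(\lambda)^{-1}d\lambda<\infty$ for some $N>0$), and $$\psi_\beta(x,\lambda)\ge\psi(\lambda)\quad\text{for all }x\in E\text{ and }\lambda\ge0.$$ Then $\mathrm{P}_{\delta_x}(X_t=0)>0$ for every $x\in E$ and every $t>0$, and hence $E_0=E$.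
   Context: $E$ is a Luzin topological space, and $\xi=(\xi_t,\Pi_x)$ is an $m$-symmetric Borel right process on $E$ with transition semigroup $P_tf(x)=\Pi_x[f(\xi_t)]$. $\mathcal{B}_b(E)$, $\mathcal{B}_b^+(E)$ are the bounded, bounded nonnegative Borel functions; $\langle f,\mu\rangle=\int f\,d\mu$; $\mathcal{M}_F(E)$ is the space of finite measures on $E$ with the weak topology and $\mathcal{M}_F^+(E)=\mathcal{M}_F(E)\setminus\{0\}$. The branching mechanism is $\psi_\beta(x,\lambda)=-\beta(x)\lambda+\alpha(x)\lambda^2+\int_{(0,\infty)}(e^{-\lambda y}-1+\lambda y)\pi(x,dy)$, $\lambda\ge0$, with $\beta\in\mathcal{B}_b(E)$, $\alpha\in\mathcal{B}_b^+(E)$ and $\pi$ a kernel from $E$ to $(0,\infty)$ with $\sup_x\int_{(0,\infty)}(y\wedge y^2)\pi(x,dy)<\infty$. The $(\xi,\psi_\beta)$-superprocess $X$ (law $\mathrm{P}_\mu$ if $X_0=\mu$) is the $\mathcal{M}_F(E)$-valued right Markov process with $\mathrm{P}_\mu[e^{-\langle f,X_t\rangle}]=e^{-\langle V_tf,\mu\rangle}$ for $f\in\mathcal{B}_b^+(E)$, where $V_tf(x)=u_f(t,x)$ is the unique nonnegative locally bounded (bounded on $[0,T]\times E$ for each $T$) solution of $u_f(t,x)=P_tf(x)-\int_0^tP_s(\psi_\beta(\cdot,u_f(t-s,\cdot)))(x)ds$. For $t>0$ one has the representation $V_tf(x)=\int_Ef(y)\Lambda_t(x,dy)+\int_{\mathcal{M}_F^+(E)}(1-e^{-\langle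 f,\nu\rangle})L_t(x,d\nu)$ with $\Lambda_t$ a bounded kernel on $E$ and $(1\wedge\langle1,\nu\rangle)L_t(x,d\nu)$ a bounded kernel from $E$ to $\mathcal{M}_F^+(E)$. $E_0:=\{x\in E:\Lambda_t(x,E)=0\text{ for all }t>0\}$; this is the set of $x$ for which the Kuznetsov (excursion) measure $\mathbb{N}_x$ of the superprocess exists. *)

theory Defs
  imports "HOL-Probability.Probability"
begin

section \<open>Topological preliminaries\<close>

definition borel_of :: "'s topology \<Rightarrow> 's measure" where
  "borel_of S = sigma (topspace S) {U. openin S U}"

lemma space_borel_of [simp]: "space (borel_of S) = topspace S"
  unfolding borel_of_def by (rule space_measure_of) (auto dest: openin_subset)

lemma borel_of_euclidean: "borel_of euclidean = borel"
  by (simp add: borel_of_def borel_def)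

text \<open>A Luzin space is a topological space homeomorphic to a Borel subset of a compact metric
  space. A compact metric space has at most continuum many points, so letting the carrier of \<open>K\<close>
  (which bears an arbitrary metric) be a set of reals is no restriction.\<close>

definition luzin_space :: "'s topology \<Rightarrow> bool" where
  "luzin_space S \<longleftrightarrow>
     (\<exists>(K :: real metric) B. compact_space (mtopology_of K) \<and> B \<in> sets (borel_of (mtopology_of K)) \<and>
        S homeomorphic_space subtopology (mtopology_of K) B)"

text \<open>The space \<open>E \<union> {\<partial>}\<close>, with the cemetery \<open>\<partial> = None\<close> adjoined as an isolated point.\<close>

definition cemetery_topology :: "'a::topological_space option topology" where
  "cemetery_topology = topology (\<lambda>U. open (Some -` U))"

lemma openin_cemetery_topology: "openin cemetery_topology U \<longleftrightarrow> open (Some -` U)"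
proof -
  have "istopology (\<lambda>U :: 'a option set. open (Some -` U))"
    by (auto simp: istopology_def vimage_Union)
  then show ?thesis
    by (simp add: cemetery_topology_def topology_inverse')
qed

lemma topspace_cemetery_topology [simp]: "topspace cemetery_topology = UNIV"
  using openin_cemetery_topology[of UNIV] by (auto simp: topspace_def)

definition finite_measures :: "'a::topological_space measure set" where
  "finite_measures = {\<mu>. sets \<mu> = sets borel \<and> finite_measure \<mu>}"

definition weak_topology :: "'a::topological_space measure topology" where
  "weak_topology = topology_generated_by
     {{\<mu> \<in> finite_measures. (\<integral>x. f x \<partial>\<mu>) \<in> U} | (f :: 'a \<Rightarrow> real) U.
        continuous_on UNIV f \<and> bounded (range f) \<and> open U}"

lemma topspace_weak_topology [simp]: "topspace weak_topology = finite_measures"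
proof -
  have "(finite_measures :: 'a measure set) \<in>
     {{\<mu> \<in> finite_measures. (\<integral>x. f x \<partial>\<mu>) \<in> U} | (f :: 'a \<Rightarrow> real) U.
        continuous_on UNIV f \<and> bounded (range f) \<and> open U}"
    by (intro CollectI exI[of _ "\<lambda>_. 0"] exI[of _ UNIV]) auto
  then show ?thesis
    unfolding weak_topology_def topology_generated_by_topspace by blast
qed


section \<open>Function spaces and kernels\<close>

definition bounded_borel :: "('a::topological_space \<Rightarrow> real) set" where
  "bounded_borel = {f \<in> borel_measurable borel. bounded (range f)}"

definition nonneg_bounded_borel :: "('a::topological_space \<Rightarrow> real) set" where
  "nonneg_bounded_borel = {f \<in> bounded_borel. \<forall>x. 0 \<le> f x}"

definition kernel :: "'a measure \<Rightarrow> 'b measure \<Rightarrow> ('a \<Rightarrow> 'b measure) \<Rightarrow> bool" where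
  "kernel A B \<kappa> \<longleftrightarrow> (\<forall>x\<in>space A. sets (\<kappa> x) = sets B) \<and>
     (\<forall>C\<in>sets B. (\<lambda>x. emeasure (\<kappa> x) C) \<in> borel_measurable A)"

definition bounded_kernel :: "'a measure \<Rightarrow> 'b measure \<Rightarrow> ('a \<Rightarrow> 'b measure) \<Rightarrow> bool" where
  "bounded_kernel A B \<kappa> \<longleftrightarrow> kernel A B \<kappa> \<and> (SUP x\<in>space A. emeasure (\<kappa> x) (space B)) < \<infinity>"


section \<open>Borel right processes\<close>

text \<open>A Borel right process on a Luzin space \<open>S\<close>: a normal, right continuous process \<open>Y\<close> with laws
  \<open>P x\<close>, Borel transition functions, and the strong Markov property with respect to a right
  continuous filtration \<open>F\<close>. Time runs through the nonnegative reals; the filtration is indexed by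
  \<open>[0, \<infinity>]\<close> so that stopping times may take the value \<open>\<infinity>\<close>. Processes with a finite lifetime
  are honest processes on the space with the cemetery adjoined.\<close>

locale borel_right_process =
  filtration "space M" F
  for M :: "'w measure" and F :: "ennreal \<Rightarrow> 'w measure" +
  fixes S :: "'s topology"
    and Y :: "real \<Rightarrow> 'w \<Rightarrow> 's"
    and P :: "'s \<Rightarrow> 'w measure"
  assumes luzin: "luzin_space S"
    and sets_F_subset: "sets (F t) \<subseteq> sets M"
    and right_continuous_filtration: "t < \<infinity> \<Longrightarrow> sets (F t) = (\<Inter>u\<in>{t<..}. sets (F u))"
    and prob_space_P: "x \<in> topspace S \<Longrightarrow> prob_space (P x)"
    and sets_P: "x \<in> topspace S \<Longrightarrow> sets (P x) = sets M"
    and adapted: "0 \<le> r \<Longrightarrow> Y r \<in> measurable (F (ennreal r)) (borel_of S)"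
    and right_continuous_paths:
      "\<omega> \<in> space M \<Longrightarrow> 0 \<le> r \<Longrightarrow> limitin S (\<lambda>s. Y s \<omega>) (Y r \<omega>) (at_right r)"
    and normal: "x \<in> topspace S \<Longrightarrow> AE \<omega> in P x. Y 0 \<omega> = x"
    and borel_transition:
      "0 \<le> r \<Longrightarrow> B \<in> sets (borel_of S) \<Longrightarrow>
        (\<lambda>x. emeasure (P x) {\<omega> \<in> space M. Y r \<omega> \<in> B}) \<in> borel_measurable (borel_of S)"
    and strong_markov:
      "x \<in> topspace S \<Longrightarrow> stopping_time F T \<Longrightarrow> A \<in> sets (pre_sigma T) \<Longrightarrow>
        0 \<le> r \<Longrightarrow> B \<in> sets (borel_of S) \<Longrightarrow>
        emeasure (P x) {\<omega> \<in> A. T \<omega> < \<infinity> \<and> Y (enn2real (T \<omega>) + r) \<omega> \<in> B} =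
        (\<integral>\<^sup>+\<omega>\<in>{\<omega> \<in> A. T \<omega> < \<infinity>}.
           emeasure (P (Y (enn2real (T \<omega>)) \<omega>)) {\<omega>' \<in> space M. Y r \<omega>' \<in> B} \<partial>P x)"

text \<open>The transition semigroup \<open>P\<^sub>t f (x) = \<P>\<^sub>x[f(\<xi>\<^sub>t)]\<close> on \<open>E\<close>, with the convention \<open>f(\<partial>) = 0\<close>.\<close>

definition transition_semigroup ::
  "(real \<Rightarrow> 'w \<Rightarrow> 'a option) \<Rightarrow> ('a option \<Rightarrow> 'w measure) \<Rightarrow> real \<Rightarrow> ('a \<Rightarrow> real) \<Rightarrow> 'a \<Rightarrow> real" where
  "transition_semigroup \<xi> \<P> t f x = (\<integral>\<omega>. case_option 0 f (\<xi> t \<omega>) \<partial>\<P> (Some x))"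

locale symmetric_borel_right_process =
  borel_right_process M F cemetery_topology \<xi> \<P>
  for M :: "'w measure" and F and \<xi> :: "real \<Rightarrow> 'w \<Rightarrow> 'a::topological_space option" and \<P> +
  fixes m :: "'a measure"
  assumes absorbing:
      "\<omega> \<in> space M \<Longrightarrow> 0 \<le> s \<Longrightarrow> s \<le> t \<Longrightarrow> \<xi> s \<omega> = None \<Longrightarrow> \<xi> t \<omega> = None"
    and sets_m: "sets m = sets borel"
    and symmetric:
      "0 \<le> t \<Longrightarrow> f \<in> nonneg_bounded_borel \<Longrightarrow> g \<in> nonneg_bounded_borel \<Longrightarrow>
        (\<integral>\<^sup>+x. ennreal (f x * transition_semigroup \<xi> \<P> t g x) \<partial>m) =
        (\<integral>\<^sup>+x. ennreal (transition_semigroup \<xi> \<P> t f x * g x) \<partial>m)"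


section \<open>Superprocesses\<close>

abbreviation positive_borel :: "real measure" where
  "positive_borel \<equiv> restrict_space borel {0<..}"

definition branching_fun :: "real \<Rightarrow> real \<Rightarrow> real measure \<Rightarrow> real \<Rightarrow> real" where
  "branching_fun b a \<eta> l = - b * l + a * l\<^sup>2 + (\<integral>y. (exp (- l * y) - 1 + l * y) \<partial>\<eta>)"

locale branching_mechanism =
  fixes \<beta> \<alpha> :: "'a::topological_space \<Rightarrow> real" and \<pi> :: "'a \<Rightarrow> real measure"
  assumes beta: "\<beta> \<in> bounded_borel"
    and alpha: "\<alpha> \<in> nonneg_bounded_borel"
    and pi_kernel: "kernel borel positive_borel \<pi>"
    and pi_bounded: "(SUP x. \<integral>\<^sup>+y. ennreal (min y (y\<^sup>2)) \<partial>\<pi> x) < \<infinity>"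

text \<open>Nonnegative locally bounded solutions of
  \<open>u(t,x) = P\<^sub>t f(x) - \<integral>\<^sub>0\<^sup>t P\<^sub>s(\<psi>(\<sqdot>, u(t-s,\<sqdot>)))(x) ds\<close>; as usual a solution is understood to be jointly
  Borel in \<open>(t,x)\<close>. Values at negative times are irrelevant.\<close>

definition mild_solution ::
  "(real \<Rightarrow> ('a::topological_space \<Rightarrow> real) \<Rightarrow> 'a \<Rightarrow> real) \<Rightarrow> ('a \<Rightarrow> real \<Rightarrow> real) \<Rightarrow>
    ('a \<Rightarrow> real) \<Rightarrow> (real \<Rightarrow> 'a \<Rightarrow> real) \<Rightarrow> bool" where
  "mild_solution P \<psi> f u \<longleftrightarrow>
     (\<lambda>(t, x). u t x) \<in> borel_measurable (restrict_space borel {0..} \<Otimes>\<^sub>M borel) \<and>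
     (\<forall>t\<ge>0. \<forall>x. 0 \<le> u t x) \<and>
     (\<forall>T\<ge>0. \<exists>C. \<forall>t\<in>{0..T}. \<forall>x. u t x \<le> C) \<and>
     (\<forall>t\<ge>0. \<forall>x. u t x = P t f x - (LBINT s:{0..t}. P s (\<lambda>y. \<psi> y (u (t - s) y)) x))"

definition log_laplace_semigroup ::
  "(real \<Rightarrow> ('a::topological_space \<Rightarrow> real) \<Rightarrow> 'a \<Rightarrow> real) \<Rightarrow> ('a \<Rightarrow> real \<Rightarrow> real) \<Rightarrow>
    (real \<Rightarrow> ('a \<Rightarrow> real) \<Rightarrow> 'a \<Rightarrow> real) \<Rightarrow> bool" where
  "log_laplace_semigroup P \<psi> V \<longleftrightarrow> (\<forall>f\<in>nonneg_bounded_borel.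
     mild_solution P \<psi> f (\<lambda>t. V t f) \<and>
     (\<forall>u. mild_solution P \<psi> f u \<longrightarrow> (\<forall>t\<ge>0. \<forall>x. u t x = V t f x)))"

locale superprocess =
  borel_right_process N G weak_topology X Q
  for N :: "'v measure" and G and X :: "real \<Rightarrow> 'v \<Rightarrow> 'a::topological_space measure" and Q +
  fixes P :: "real \<Rightarrow> ('a \<Rightarrow> real) \<Rightarrow> 'a \<Rightarrow> real"
    and \<psi> :: "'a \<Rightarrow> real \<Rightarrow> real"
    and V :: "real \<Rightarrow> ('a \<Rightarrow> real) \<Rightarrow> 'a \<Rightarrow> real"
  assumes log_laplace: "log_laplace_semigroup P \<psi> V"
    and laplace_functional:
      "\<mu> \<in> finite_measures \<Longrightarrow> 0 \<le> t \<Longrightarrow> f \<in> nonneg_bounded_borel \<Longrightarrow>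
        (\<integral>\<omega>. exp (- (\<integral>x. f x \<partial>X t \<omega>)) \<partial>Q \<mu>) = exp (- (\<integral>x. V t f x \<partial>\<mu>))"

definition nonzero_finite_measures :: "'a::topological_space measure measure" where
  "nonzero_finite_measures = borel_of (subtopology weak_topology (finite_measures - {null_measure borel}))"

text \<open>In \<open>bounded_L\<close> the density is that of \<open>(1 \<and> \<langle>1,\<nu>\<rangle>) L\<^sub>t(x,d\<nu>)\<close>; the measures \<open>L\<^sub>t(x,\<sqdot>)\<close>
  themselves may be infinite.\<close>

locale canonical_representation =
  fixes V :: "real \<Rightarrow> ('a::topological_space \<Rightarrow> real) \<Rightarrow> 'a \<Rightarrow> real"
    and \<Lambda> :: "real \<Rightarrow> 'a \<Rightarrow> 'a measure"
    and L :: "real \<Rightarrow> 'a \<Rightarrow> 'a measure measure"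
  assumes bounded_Lambda: "0 < t \<Longrightarrow> bounded_kernel borel borel (\<Lambda> t)"
    and sets_L: "0 < t \<Longrightarrow> sets (L t x) = sets nonzero_finite_measures"
    and bounded_L: "0 < t \<Longrightarrow> bounded_kernel borel nonzero_finite_measures
          (\<lambda>x. density (L t x) (\<lambda>\<nu>. min 1 (emeasure \<nu> UNIV)))"
    and representation:
      "0 < t \<Longrightarrow> f \<in> nonneg_bounded_borel \<Longrightarrow>
        V t f x = (\<integral>y. f y \<partial>\<Lambda> t x) + (\<integral>\<nu>. (1 - exp (- (\<integral>y. f y \<partial>\<nu>))) \<partial>L t x)"

definition E0 :: "(real \<Rightarrow> 'a \<Rightarrow> 'a measure) \<Rightarrow> 'a set" where
  "E0 \<Lambda> = {x. \<forall>t>0. emeasure (\<Lambda> t x) UNIV = 0}"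

end

theory Submission
  imports Defs
begin

text \<open>
  The theorem follows from a bound on the cumulant semigroup that does not depend on the initial
  function: for every \<open>t > 0\<close> there is a constant \<open>c\<close> with \<open>V\<^sub>t f(x) \<le> c\<close> for all \<open>f\<close> and \<open>x\<close>
  (\<open>log_laplace_le\<close>). Taking \<open>f = k\<close> constant, \<open>P\<^bsub>\<delta>\<^sub>x\<^esub>[exp (- k \<langle>1, X\<^sub>t\<rangle>)] = exp (- V\<^sub>t k(x)) \<ge> exp (- c)\<close>,
  and \<open>k \<rightarrow> \<infinity>\<close> gives \<open>P\<^bsub>\<delta>\<^sub>x\<^esub>(X\<^sub>t = 0) \<ge> exp (- c)\<close>. Likewise \<open>k \<Lambda>\<^sub>t(x, E) \<le> V\<^sub>t k(x) \<le> c\<close> for all \<open>k\<close>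
  is possible only if \<open>\<Lambda>\<^sub>t(x, E) = 0\<close>.

  For the bound, fix \<open>t\<close> and \<open>x\<close>, write \<open>u\<^sub>r = V\<^sub>r f\<close>, and look at \<open>U(r) = P\<^sub>r u\<^bsub>t-r\<^esub>(x)\<close> for \<open>0 \<le> r \<le> t\<close>,
  which leads from \<open>U(0) = u\<^sub>t(x)\<close> to \<open>U(t) = P\<^sub>t f(x)\<close>. By Fubini's theorem and the semigroup property, the
  mild equation says that \<open>U\<close> is an indefinite integral of \<open>W(r) = P\<^sub>r(\<psi>\<^sub>\<beta>(\<cdot>, u\<^bsub>t-r\<^esub>))(x)\<close>
  (\<open>mild_flow_identity\<close>). Since \<open>\<psi>\<^sub>\<beta> \<ge> \<psi>\<close> and \<open>\<psi>\<close> is convex with \<open>\<psi>(0) = 0\<close>, Jensen's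
  inequality, which under these conditions also holds for sub-Markov kernels, gives
  \<open>W(r) \<ge> \<psi>(U(r))\<close>. So \<open>U\<close> grows at least as fast as a solution of \<open>y' = \<psi>(y)\<close>, and such a solution, once
  it is in the region where \<open>\<psi>\<close> is positive and increasing, explodes after the time
  \<open>\<integral>\<^bsub>y(0)\<^esub>\<^sup>\<infinity> d\<lambda> / \<psi>(\<lambda>)\<close>. As \<open>U\<close> is finite on all of \<open>[0, t]\<close>, that time cannot be small compared
  with \<open>t\<close> (\<open>time_le_blow_up_time\<close>), and because it tends to \<open>0\<close> as \<open>y(0) \<rightarrow> \<infinity>\<close>, this bounds
  \<open>U(0) = u\<^sub>t(x)\<close> in terms of \<open>t\<close> and \<open>\<psi>\<close> alone.

  Working with one pair \<open>(t, x)\<close> at a time in this way avoids suprema over \<open>x\<close>, and inequalities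
  between integrals replace the solution of the differential equation. The application of Fubini's theorem
  needs the transition kernels to be measurable jointly in time and space; this comes from right continuity
  of the paths and metrizability of the state space (\<open>measurable_transition_kernel\<close>).
\<close>


section \<open>Measurability of right continuous families\<close>

text \<open>The integral against \<open>L x\<close> is one against the image of \<open>L x\<close> under \<open>y \<mapsto> (x, y)\<close>, where the
  integrand no longer depends on \<open>x\<close>.\<close>

lemma borel_measurable_integral_kernel:
  fixes f :: "'a \<Rightarrow> 'b \<Rightarrow> real"
  assumes f [measurable]: "case_prod f \<in> borel_measurable (M \<Otimes>\<^sub>M N)"
    and L [measurable]: "L \<in> measurable M (subprob_algebra N)"
  shows "(\<lambda>x. \<integral>y. f x y \<partial>L x) \<in> borel_measurable M"
proof -
  have "(\<lambda>x. \<integral>z. case_prod f z \<partial>distr (L x) (M \<Otimes>\<^sub>M N) (Pair x)) \<in> borel_measurable M"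
    by (rule measurable_compose[OF _ integral_measurable_subprob_algebra])
       (auto intro!: measurable_distr2[where M=N] simp: case_prod_beta')
  also have "?this \<longleftrightarrow> ?thesis"
  proof (rule measurable_cong)
    fix x assume x: "x \<in> space M"
    have "Pair x \<in> measurable (L x) (M \<Otimes>\<^sub>M N)"
      using x by (simp add: measurable_cong_sets[OF subprob_measurableD(2)[OF L x] refl])
    then show "(\<integral>z. case_prod f z \<partial>distr (L x) (M \<Otimes>\<^sub>M N) (Pair x)) = (\<integral>y. f x y \<partial>L x)"
      by (simp only: integral_distr[OF _ f] prod.case)
  qed
  finally show ?thesis .
qed

text \<open>Time is approximated from the right by points of a grid of mesh \<open>1 / (n + 1)\<close>: with time
  restricted to a countable set, joint measurability is immediate, and it passes to the limit. Negative
  times are mapped to \<open>0\<close> so that the result lives on the whole line.\<close>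

lemma borel_measurable_right_continuous_family:
  fixes f :: "real \<Rightarrow> 'a \<Rightarrow> real"
  assumes f: "\<And>s. 0 \<le> s \<Longrightarrow> f s \<in> borel_measurable M"
    and rc: "\<And>s x X. 0 \<le> s \<Longrightarrow> x \<in> space M \<Longrightarrow> (\<And>n. s < X n) \<Longrightarrow> X \<longlonglongrightarrow> s \<Longrightarrow>
               (\<lambda>n. f (X n) x) \<longlonglongrightarrow> f s x"
  shows "(\<lambda>(s, x). f (max 0 s) x) \<in> borel_measurable (borel \<Otimes>\<^sub>M M)"
proof -
  \<comment> \<open>the next grid point strictly to the right of \<open>max 0 s\<close>, so that right continuity applies\<close>
  define d :: "nat \<Rightarrow> real \<Rightarrow> real"
    where "d n s = (of_int \<lfloor>real (Suc n) * max 0 s\<rfloor> + 1) / real (Suc n)" for n s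
  have d1: "max 0 s < d n s" for n s
  proof -
    have "real (Suc n) * max 0 s < of_int \<lfloor>real (Suc n) * max 0 s\<rfloor> + 1"
      by linarith
    then show ?thesis by (simp only: d_def pos_less_divide_eq of_nat_0_less_iff zero_less_Suc mult.commute)
  qed
  have d2: "d n s \<le> max 0 s + 1 / real (Suc n)" for n s
  proof -
    have "of_int \<lfloor>real (Suc n) * max 0 s\<rfloor> \<le> real (Suc n) * max 0 s"
      by linarith
    then show ?thesis
      by (simp add: d_def pos_divide_le_eq mult.commute[of _ "real (Suc n)"] distrib_left del: of_nat_Suc)
  qed
  have lim: "(\<lambda>n. d n s) \<longlonglongrightarrow> max 0 s" for s
  proof (rule tendsto_sandwich)
    show "(\<lambda>n. max 0 s) \<longlonglongrightarrow> max 0 s" by simp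
    show "(\<lambda>n. max 0 s + 1 / real (Suc n)) \<longlonglongrightarrow> max 0 s"
      using tendsto_add[OF tendsto_const[of "max 0 s"] LIMSEQ_inverse_real_of_nat] by (simp add: inverse_eq_divide)
  qed (simp_all only: d2 less_imp_le[OF d1] eventually_True)
  have meas: "(\<lambda>(s, x). f (d n s) x) \<in> borel_measurable (borel \<Otimes>\<^sub>M M)" for n
  proof -
    have "(\<lambda>p. f ((of_int \<lfloor>real (Suc n) * max 0 (fst p)\<rfloor> + 1) / real (Suc n)) (snd p))
        \<in> borel_measurable (borel \<Otimes>\<^sub>M M)"
    proof (rule measurable_compose_countable'[where I="{0..}" and g="\<lambda>p. \<lfloor>real (Suc n) * max 0 (fst p)\<rfloor>"
          and f="\<lambda>i p. f ((of_int i + 1) / real (Suc n)) (snd p)"])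
      fix i :: int assume "i \<in> {0..}"
      then have [measurable]: "f ((of_int i + 1) / real (Suc n)) \<in> borel_measurable M"
        by (intro f) auto
      show "(\<lambda>p. f ((of_int i + 1) / real (Suc n)) (snd p)) \<in> borel_measurable (borel \<Otimes>\<^sub>M M)"
        by measurable
    next
      have m: "(\<lambda>p. \<lfloor>real (Suc n) * max 0 (fst p)\<rfloor>) \<in> measurable ((borel :: real measure) \<Otimes>\<^sub>M M) (count_space UNIV)"
        by measurable
      show "(\<lambda>p. \<lfloor>real (Suc n) * max 0 (fst p)\<rfloor>) \<in> measurable ((borel :: real measure) \<Otimes>\<^sub>M M) (count_space {0..})"
        by (rule measurable_count_space_extend[OF subset_UNIV _ m]) auto
    qed auto
    then show ?thesis by (simp add: d_def case_prod_beta')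
  qed
  show ?thesis
  proof (rule borel_measurable_LIMSEQ_real)
    fix p :: "real \<times> 'a" assume p: "p \<in> space (borel \<Otimes>\<^sub>M M)"
    then show "(\<lambda>n. (\<lambda>(s, x). f (d n s) x) p) \<longlonglongrightarrow> (\<lambda>(s, x). f (max 0 s) x) p"
      using rc[of "max 0 (fst p)" "snd p" "\<lambda>n. d n (fst p)"] d1 lim
      by (auto simp: space_pair_measure case_prod_beta')
  qed (rule meas)
qed

text \<open>Right continuity of paths controls only integrals of continuous functions. In a metrizable space
  these determine the measures of open sets: an open set is an increasing union of closed sets,
  and Urysohn functions for these converge to its indicator.\<close>

lemma metrizable_open_indicator_limit:
  assumes "metrizable_space S" "openin S U"
  obtains g :: "nat \<Rightarrow> 'a \<Rightarrow> real" where
    "\<And>n. continuous_map S euclideanreal (g n)"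
    "\<And>n x. x \<in> topspace S \<Longrightarrow> \<bar>g n x\<bar> \<le> 1"
    "\<And>x. x \<in> topspace S \<Longrightarrow> (\<lambda>n. g n x) \<longlonglongrightarrow> indicator U x"
proof -
  obtain C where C: "\<And>n. closedin S (C n)" "\<And>n::nat. C n \<subseteq> C (Suc n)" "\<Union> (range C) = U"
    using open_imp_fsigma_in[OF assms] unfolding fsigma_in_ascending by blast
  have "\<exists>g. continuous_map S (top_of_set {0..1::real}) g \<and> g ` (topspace S - U) \<subseteq> {0} \<and> g ` C n \<subseteq> {1}" for n
  proof -
    have "closedin S (topspace S - U)" using assms by blast
    moreover have "disjnt (topspace S - U) (C n)" using C(3) by (auto simp: disjnt_def)
    ultimately obtain g :: "'a \<Rightarrow> real" where
      "continuous_map S (top_of_set {0..1}) g" "g ` (topspace S - U) \<subseteq> {0}" "g ` C n \<subseteq> {1}"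
      using Urysohn_lemma[OF metrizable_imp_normal_space[OF assms(1)] _ C(1)[of n], of _ 0 1] by auto
    then show ?thesis by blast
  qed
  then obtain g where g: "\<And>n. continuous_map S (top_of_set {0..1::real}) (g n)"
      "\<And>n. g n ` (topspace S - U) \<subseteq> {0}" "\<And>n. g n ` C n \<subseteq> {1}" by metis
  show thesis
  proof
    fix n show "continuous_map S euclideanreal (g n)"
      using g(1)[of n] by (simp add: continuous_map_in_subtopology)
    fix x assume "x \<in> topspace S"
    then show "\<bar>g n x\<bar> \<le> 1"
      using continuous_map_image_subset_topspace[OF g(1)[of n]] by (auto simp: image_subset_iff)
  next
    fix x assume x: "x \<in> topspace S"
    show "(\<lambda>n. g n x) \<longlonglongrightarrow> indicator U x"
    proof (cases "x \<in> U")
      case True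
      then obtain k where "x \<in> C k" using C(3) by auto
      then have "x \<in> C n" if "n \<ge> k" for n
        using lift_Suc_mono_le[of C, OF C(2) that] by auto
      then have "g n x = 1" if "n \<ge> k" for n using g(3)[of n] that by auto
      then show ?thesis using True
        by (intro tendsto_eventually) (auto simp: eventually_sequentially)
    next
      case False
      then have "g n x = 0" for n using g(2)[of n] x by auto
      then show ?thesis using False by simp
    qed
  qed
qed

lemma borel_measurable_continuous_map:
  fixes g :: "'s \<Rightarrow> real"
  assumes "continuous_map S euclideanreal g"
  shows "g \<in> borel_measurable (borel_of S)"
proof (rule borel_measurableI)
  fix U :: "real set" assume "open U"
  then have "openin S {x \<in> topspace S. g x \<in> U}"
    using assms by (simp add: continuous_map_def)
  then show "g -` U \<inter> space (borel_of S) \<in> sets (borel_of S)"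
    unfolding borel_of_def by (auto simp: vimage_def Collect_conj_eq Int_commute sets_measure_of_conv intro!: sigma_sets.Basic dest: openin_subset)
qed

lemma sets_borel_of: "sets (borel_of S) = sigma_sets (topspace S) {U. openin S U}"
  unfolding borel_of_def by (rule sets_measure_of) (auto dest: openin_subset)

lemma luzin_space_imp_metrizable:
  assumes "luzin_space S" shows "metrizable_space S"
proof -
  obtain K :: "real metric" and B where h: "S homeomorphic_space subtopology (mtopology_of K) B"
    using assms unfolding luzin_space_def by blast
  have "metrizable_space (mtopology_of K)"
    unfolding mtopology_of_def by (rule Metric_space.metrizable_space_mtopology) simp
  then have "metrizable_space (subtopology (mtopology_of K) B)"
    by (rule metrizable_space_subtopology)
  then show ?thesis
    using homeomorphic_metrizable_space[OF h] by simp
qed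

section \<open>Transition kernels of Borel right processes\<close>

text \<open>Only times \<open>s \<ge> 0\<close> matter. The kernels are indexed by the whole line so that joint
  measurability can be stated on a product with the Borel sets of the reals.\<close>

locale measurable_markov_semigroup =
  fixes S :: "'s measure" and K :: "real \<Rightarrow> 's \<Rightarrow> 's measure"
  assumes measurable_kernel: "case_prod K \<in> measurable (borel \<Otimes>\<^sub>M S) (prob_algebra S)"
    and chapman_kolmogorov: "0 \<le> r \<Longrightarrow> 0 \<le> s \<Longrightarrow> z \<in> space S \<Longrightarrow> K r z \<bind> K s = K (r + s) z"

context borel_right_process
begin

definition transition_kernel :: "real \<Rightarrow> 's \<Rightarrow> 's measure" where
  "transition_kernel s z = distr (P z) (borel_of S) (Y (max 0 s))"

lemma measurable_process:
  assumes "z \<in> topspace S" "0 \<le> r"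
  shows "Y r \<in> measurable (P z) (borel_of S)"
proof -
  have "Y r \<in> measurable (F (ennreal r)) (borel_of S)"
    by (rule adapted) fact
  then have "Y r \<in> measurable M (borel_of S)"
    using sets_F_subset[of "ennreal r"] space_F[of "ennreal r"] by (auto simp: measurable_def)
  then show ?thesis
    using measurable_cong_sets[OF sets_P[OF assms(1)] refl] by blast
qed

lemma space_P: "z \<in> topspace S \<Longrightarrow> space (P z) = space M"
  using sets_P by (rule sets_eq_imp_space_eq)

lemma emeasure_transition_kernel:
  assumes "z \<in> topspace S" "0 \<le> s" "B \<in> sets (borel_of S)"
  shows "emeasure (transition_kernel s z) B = emeasure (P z) {\<omega> \<in> space M. Y s \<omega> \<in> B}"
  using assms measurable_process[OF assms(1,2)]
  by (auto simp: transition_kernel_def emeasure_distr space_P intro!: arg_cong[where f="emeasure _"])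

lemma integral_transition_kernel:
  fixes f :: "'s \<Rightarrow> real"
  assumes "z \<in> topspace S" "0 \<le> s" "f \<in> borel_measurable (borel_of S)"
  shows "(\<integral>y. f y \<partial>transition_kernel s z) = (\<integral>\<omega>. f (Y s \<omega>) \<partial>P z)"
  using assms measurable_process[OF assms(1,2)]
  by (simp add: transition_kernel_def integral_distr max_absorb2)

lemma prob_space_transition_kernel:
  "z \<in> topspace S \<Longrightarrow> prob_space (transition_kernel s z)"
  unfolding transition_kernel_def
  by (intro prob_space.prob_space_distr prob_space_P measurable_process) auto

lemma sets_transition_kernel [simp]: "sets (transition_kernel s z) = sets (borel_of S)"
  by (simp add: transition_kernel_def)

lemma transition_kernel_max: "transition_kernel (max 0 s) = transition_kernel s"
  by (simp add: transition_kernel_def fun_eq_iff)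

lemma measurable_transition_kernel_fixed_time:
  assumes "0 \<le> s"
  shows "transition_kernel s \<in> measurable (borel_of S) (subprob_algebra (borel_of S))"
proof (rule measurable_subprob_algebra)
  fix B assume B: "B \<in> sets (borel_of S)"
  show "(\<lambda>z. emeasure (transition_kernel s z) B) \<in> borel_measurable (borel_of S)"
    using borel_transition[OF assms B] emeasure_transition_kernel[OF _ assms B]
    by (subst measurable_cong) auto
qed (auto intro: prob_space_imp_subprob_space prob_space_transition_kernel)

text \<open>Bounded convergence along the right continuous paths.\<close>

lemma tendsto_expectation_right:
  fixes g :: "'s \<Rightarrow> real"
  assumes g: "continuous_map S euclideanreal g" "\<And>x. x \<in> topspace S \<Longrightarrow> \<bar>g x\<bar> \<le> C"
    and z: "z \<in> topspace S" and s: "0 \<le> s" and X: "\<And>n. s < X n" "X \<longlonglongrightarrow> s"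
  shows "(\<lambda>n. \<integral>y. g y \<partial>transition_kernel (X n) z) \<longlonglongrightarrow> (\<integral>y. g y \<partial>transition_kernel s z)"
proof -
  interpret prob_space "P z" by (rule prob_space_P[OF z])
  have X0: "0 \<le> X n" for n using X(1)[of n] s by simp
  have gm: "g \<in> borel_measurable (borel_of S)" by (rule borel_measurable_continuous_map) fact
  have m: "(\<lambda>\<omega>. g (Y r \<omega>)) \<in> borel_measurable (P z)" if "0 \<le> r" for r
    by (rule measurable_compose[OF measurable_process[OF z that] gm])
  have "(\<lambda>n. \<integral>\<omega>. g (Y (X n) \<omega>) \<partial>P z) \<longlonglongrightarrow> (\<integral>\<omega>. g (Y s \<omega>) \<partial>P z)"
  proof (rule integral_dominated_convergence[where w="\<lambda>_. C"])
    show "AE \<omega> in P z. (\<lambda>n. g (Y (X n) \<omega>)) \<longlonglongrightarrow> g (Y s \<omega>)"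
    proof (rule AE_I2)
      fix \<omega> assume "\<omega> \<in> space (P z)"
      then have "limitin S (\<lambda>s. Y s \<omega>) (Y s \<omega>) (at_right s)"
        using right_continuous_paths[OF _ s] z by (simp add: space_P)
      then have "limitin euclideanreal (g \<circ> (\<lambda>s. Y s \<omega>)) (g (Y s \<omega>)) (at_right s)"
        by (rule continuous_map_limit[OF g(1)])
      then have "((\<lambda>s. g (Y s \<omega>)) \<longlongrightarrow> g (Y s \<omega>)) (at_right s)"
        by (simp add: limitin_canonical_iff o_def)
      moreover have "filterlim X (at_right s) sequentially"
        using X by (auto simp: filterlim_at intro!: always_eventually)
      ultimately show "(\<lambda>n. g (Y (X n) \<omega>)) \<longlonglongrightarrow> g (Y s \<omega>)"
        by (rule filterlim_compose)
    qed
    show "AE \<omega> in P z. norm (g (Y (X n) \<omega>)) \<le> C" for n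
      using g(2) measurable_space[OF measurable_process[OF z X0[of n]]] by (intro AE_I2) auto
  qed (use m s X0 in auto)
  then show ?thesis
    using integral_transition_kernel[OF z s gm] integral_transition_kernel[OF z X0 gm] by simp
qed

text \<open>Expectations of bounded continuous functions are right continuous in time and Borel in the starting
  point, hence jointly measurable. Indicators of open sets are limits of such functions, and the open
  sets are an intersection-stable generator.\<close>

lemma measurable_transition_kernel:
  "case_prod transition_kernel \<in> measurable (borel \<Otimes>\<^sub>M borel_of S) (prob_algebra (borel_of S))"
proof (rule measurable_prob_algebraI)
  let ?B = "borel \<Otimes>\<^sub>M borel_of S :: (real \<times> 's) measure"
  have ts: "snd p \<in> topspace S" if "p \<in> space ?B" for p :: "real \<times> 's"
    using that by (auto simp: space_pair_measure)
  show "prob_space (case_prod transition_kernel p)" if "p \<in> space ?B" for p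
    using prob_space_transition_kernel[OF ts[OF that]] by (simp add: case_prod_beta)
  show "case_prod transition_kernel \<in> ?B \<rightarrow>\<^sub>M subprob_algebra (borel_of S)"
  proof (rule measurable_subprob_algebra_generated[OF sets_borel_of])
    show "Int_stable {U. openin S U}" by (auto simp: Int_stable_def)
    show "{U. openin S U} \<subseteq> Pow (topspace S)" by (auto dest: openin_subset)
    show "subprob_space (case_prod transition_kernel p)" if "p \<in> space ?B" for p
      using prob_space_transition_kernel[OF ts[OF that]] 
      by (simp add: case_prod_beta prob_space_imp_subprob_space)
    show "sets (case_prod transition_kernel p) = sets (borel_of S)" for p
      by (simp add: case_prod_beta)
    have "(\<lambda>p. emeasure (case_prod transition_kernel p) U) \<in> borel_measurable ?B"
      if U: "openin S U" for U
    proof -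
      obtain g :: "nat \<Rightarrow> 's \<Rightarrow> real" where g: "\<And>n. continuous_map S euclideanreal (g n)"
        "\<And>n x. x \<in> topspace S \<Longrightarrow> \<bar>g n x\<bar> \<le> 1"
        "\<And>x. x \<in> topspace S \<Longrightarrow> (\<lambda>n. g n x) \<longlonglongrightarrow> indicator U x"
        using metrizable_open_indicator_limit[OF luzin_space_imp_metrizable[OF luzin] U] by blast
      have gm[measurable]: "g n \<in> borel_measurable (borel_of S)" for n
        by (rule borel_measurable_continuous_map[OF g(1)])
      have Um: "U \<in> sets (borel_of S)" using U by (simp add: sets_borel_of sigma_sets.Basic)
      have "(\<lambda>(s, z). \<integral>y. g n y \<partial>transition_kernel (max 0 s) z) \<in> borel_measurable ?B" for n
      proof (rule borel_measurable_right_continuous_family)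
        show "(\<lambda>z. \<integral>y. g n y \<partial>transition_kernel s z) \<in> borel_measurable (borel_of S)" if "0 \<le> s" for s
          using measurable_transition_kernel_fixed_time[OF that] gm
          by (rule measurable_compose[OF _ integral_measurable_subprob_algebra])
        show "(\<lambda>k. \<integral>y. g n y \<partial>transition_kernel (X k) z) \<longlonglongrightarrow> (\<integral>y. g n y \<partial>transition_kernel s z)"
          if "0 \<le> s" "z \<in> space (borel_of S)" "\<And>k. s < X k" "X \<longlonglongrightarrow> s" for s z X
          using that g(2) by (intro tendsto_expectation_right[OF g(1), where C=1]) auto
      qed
      then have gn: "(\<lambda>p. \<integral>y. g n y \<partial>case_prod transition_kernel p) \<in> borel_measurable ?B" for n
        by (simp add: transition_kernel_max case_prod_beta')
      have "(\<lambda>p. measure (case_prod transition_kernel p) U) \<in> borel_measurable ?B"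
      proof (rule borel_measurable_LIMSEQ_real)
        fix p assume p: "p \<in> space ?B"
        interpret prob_space "case_prod transition_kernel p"
          using prob_space_transition_kernel[OF ts[OF p]] by (simp add: case_prod_beta)
        have sp: "sets (case_prod transition_kernel p) = sets (borel_of S)" by (simp add: case_prod_beta)
        then have sp': "space (case_prod transition_kernel p) = topspace S"
          using sets_eq_imp_space_eq[OF sp] by simp
        have "(\<lambda>n. \<integral>y. g n y \<partial>case_prod transition_kernel p) \<longlonglongrightarrow> (\<integral>y. indicator U y \<partial>case_prod transition_kernel p)"
          by (rule integral_dominated_convergence[where w="\<lambda>_. 1"])
             (use g gm Um in \<open>auto simp: sp' measurable_cong_sets[OF sp refl] sp\<close>)
        then show "(\<lambda>n. \<integral>y. g n y \<partial>case_prod transition_kernel p) \<longlonglongrightarrow> measure (case_prod transition_kernel p) U"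
          using Um sp by simp
      qed (rule gn)
      then have "(\<lambda>p. ennreal (measure (case_prod transition_kernel p) U)) \<in> borel_measurable ?B"
        by measurable
      also have "?this \<longleftrightarrow> ?thesis"
      proof (rule measurable_cong)
        fix p assume p: "p \<in> space ?B"
        interpret prob_space "case_prod transition_kernel p"
          using prob_space_transition_kernel[OF ts[OF p]] by (simp add: case_prod_beta)
        show "ennreal (measure (case_prod transition_kernel p) U) = emeasure (case_prod transition_kernel p) U"
          by (simp add: emeasure_eq_measure)
      qed
      finally show ?thesis .
    qed
    then show "(\<lambda>p. emeasure (case_prod transition_kernel p) U) \<in> borel_measurable ?B"
      if "U \<in> {U. openin S U}" for U
      using that by auto
    from this[of "topspace S"]
    show "(\<lambda>p. emeasure (case_prod transition_kernel p) (topspace S)) \<in> borel_measurable ?B"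
      by simp
  qed
qed

text \<open>This is the strong Markov property at the constant time \<open>r\<close>.\<close>

lemma transition_kernel_bind:
  assumes "0 \<le> r" "0 \<le> s" and z: "z \<in> topspace S"
  shows "transition_kernel r z \<bind> transition_kernel s = transition_kernel (r + s) z"
proof (rule measure_eqI)
  have ne: "space (transition_kernel r z) \<noteq> {}"
    using prob_space.not_empty[OF prob_space_transition_kernel[OF z]] .
  have km: "transition_kernel s \<in> measurable (transition_kernel r z) (subprob_algebra (borel_of S))"
    using measurable_transition_kernel_fixed_time[OF assms(2)]
    by (simp add: measurable_cong_sets[OF sets_transition_kernel refl])
  show "sets (transition_kernel r z \<bind> transition_kernel s) = sets (transition_kernel (r + s) z)"
    using ne by (subst sets_bind[where N="borel_of S"]) auto
  fix B assume "B \<in> sets (transition_kernel r z \<bind> transition_kernel s)"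
  then have B: "B \<in> sets (borel_of S)"
    using ne by (subst (asm) sets_bind[where N="borel_of S"]) auto
  let ?T = "\<lambda>_ :: 'w. ennreal r"
  have T: "stopping_time F ?T" by (rule stopping_time_const)
  have "space M \<in> sets (pre_sigma ?T)"
    using sets.top[of "pre_sigma ?T"] by (simp only: space_pre_sigma)
  from strong_markov[OF z T this assms(2) B]
  have sm: "emeasure (P z) {\<omega> \<in> space M. Y (r + s) \<omega> \<in> B} =
      (\<integral>\<^sup>+\<omega>\<in>space M. emeasure (P (Y r \<omega>)) {\<omega>' \<in> space M. Y s \<omega>' \<in> B} \<partial>P z)"
    using assms(1) by simp
  have "emeasure (transition_kernel r z \<bind> transition_kernel s) B
      = (\<integral>\<^sup>+y. emeasure (transition_kernel s y) B \<partial>transition_kernel r z)"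
    by (rule emeasure_bind[OF ne km B])
  also have "\<dots> = (\<integral>\<^sup>+\<omega>. emeasure (transition_kernel s (Y r \<omega>)) B \<partial>P z)"
    using measurable_process[OF z assms(1)] measurable_transition_kernel_fixed_time[OF assms(2)] B assms(1)
    unfolding transition_kernel_def[of r]
    by (subst nn_integral_distr) (auto intro!: measurable_emeasure_kernel)
  also have "\<dots> = (\<integral>\<^sup>+\<omega>\<in>space M. emeasure (P (Y r \<omega>)) {\<omega>' \<in> space M. Y s \<omega>' \<in> B} \<partial>P z)"
    using measurable_space[OF measurable_process[OF z assms(1)]]
    by (intro nn_integral_cong) (simp add: emeasure_transition_kernel assms B space_P z)
  also have "\<dots> = emeasure (transition_kernel (r + s) z) B"
    using assms B by (simp add: sm emeasure_transition_kernel)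
  finally show "emeasure (transition_kernel r z \<bind> transition_kernel s) B = emeasure (transition_kernel (r + s) z) B" .
qed

sublocale transition: measurable_markov_semigroup "borel_of S" transition_kernel
  by unfold_locales (auto intro: measurable_transition_kernel transition_kernel_bind)

end

section \<open>The mild equation along a Markov semigroup\<close>

context measurable_markov_semigroup
begin

lemma prob_space_kernel: "z \<in> space S \<Longrightarrow> prob_space (K s z)"
  and sets_kernel: "z \<in> space S \<Longrightarrow> sets (K s z) = sets S"
  using measurable_space[OF measurable_kernel, of "(s, z)"]
  by (auto simp: space_pair_measure space_prob_algebra)

lemma space_kernel: "z \<in> space S \<Longrightarrow> space (K s z) = space S"
  by (rule sets_eq_imp_space_eq[OF sets_kernel])

lemma measurable_kernel_section: "K s \<in> measurable S (subprob_algebra S)"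
  using measurable_compose[OF measurable_Pair1' measurable_prob_algebraD[OF measurable_kernel], of s] by simp

lemma integrable_kernel:
  fixes g :: "'s \<Rightarrow> real"
  assumes "g \<in> borel_measurable S" "\<And>y. y \<in> space S \<Longrightarrow> \<bar>g y\<bar> \<le> B" "z \<in> space S"
  shows "integrable (K s z) g"
proof -
  interpret prob_space "K s z" by (rule prob_space_kernel) fact
  show ?thesis
    using assms by (intro integrable_const_bound[where B=B])
      (auto simp: measurable_cong_sets[OF sets_kernel refl] space_kernel)
qed

lemma abs_integral_kernel_le:
  fixes g :: "'s \<Rightarrow> real"
  assumes "g \<in> borel_measurable S" "\<And>y. y \<in> space S \<Longrightarrow> \<bar>g y\<bar> \<le> B" "z \<in> space S"
  shows "\<bar>\<integral>y. g y \<partial>K s z\<bar> \<le> B"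
proof -
  interpret prob_space "K s z" by (rule prob_space_kernel) fact
  have "\<bar>\<integral>y. g y \<partial>K s z\<bar> \<le> (\<integral>y. \<bar>g y\<bar> \<partial>K s z)"
    using integral_norm_bound[of "K s z" g] by simp
  also have "\<dots> \<le> (\<integral>y. B \<partial>K s z)"
    using assms by (intro integral_mono integrable_abs integrable_kernel[where B=B] integrable_const)
      (auto simp: space_kernel)
  finally show ?thesis by (simp add: prob_space)
qed

lemma integral_kernel_kernel:
  fixes g :: "'s \<Rightarrow> real"
  assumes g: "g \<in> borel_measurable S" "\<And>y. y \<in> space S \<Longrightarrow> \<bar>g y\<bar> \<le> B"
    and "0 \<le> r" "0 \<le> s" and z: "z \<in> space S"
  shows "(\<integral>y. (\<integral>x. g x \<partial>K s y) \<partial>K r z) = (\<integral>x. g x \<partial>K (r + s) z)"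
proof -
  interpret prob_space "K r z" by (rule prob_space_kernel[OF z])
  have "(\<integral>x. g x \<partial>(K r z \<bind> K s)) = (\<integral>y. (\<integral>x. g x \<partial>K s y) \<partial>K r z)"
  proof (rule integral_bind[where K=S and B=B and B'=1])
    show "K s \<in> measurable (K r z) (subprob_algebra S)"
      using measurable_kernel_section by (simp add: measurable_cong_sets[OF sets_kernel[OF z] refl])
    show "AE x in K r z. emeasure (K s x) (space (K s x)) \<le> ennreal 1"
      using prob_space.emeasure_space_1[OF prob_space_kernel] by (intro AE_I2) (auto simp: space_kernel[OF z])
  qed (use g in auto)
  then show ?thesis using chapman_kolmogorov[OF assms(3,4) z] by simp
qed

lemma borel_measurable_integral_kernel_time:
  fixes \<Phi> :: "real \<Rightarrow> 's \<Rightarrow> real"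
  assumes \<Phi>: "case_prod \<Phi> \<in> borel_measurable (borel \<Otimes>\<^sub>M S)"
  shows "(\<lambda>(s, z). \<integral>y. \<Phi> (c - s) y \<partial>K s z) \<in> borel_measurable (borel \<Otimes>\<^sub>M S)"
proof -
  have "(\<lambda>p. \<integral>y. \<Phi> (c - fst p) y \<partial>case_prod K p) \<in> borel_measurable (borel \<Otimes>\<^sub>M S)"
  proof (rule borel_measurable_integral_kernel)
    have "(\<lambda>q. case_prod \<Phi> (c - fst (fst q), snd q)) \<in> borel_measurable ((borel \<Otimes>\<^sub>M S) \<Otimes>\<^sub>M S)"
      by (rule measurable_compose[OF _ \<Phi>]) simp
    then show "(\<lambda>(p, y). \<Phi> (c - fst p) y) \<in> borel_measurable ((borel \<Otimes>\<^sub>M S) \<Otimes>\<^sub>M S)"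
      by (simp add: case_prod_beta')
  qed (rule measurable_prob_algebraD[OF measurable_kernel])
  then show ?thesis by (simp add: case_prod_beta')
qed

text \<open>Suppose that \<open>u(t) = K\<^sub>t f - \<integral>\<^sub>0\<^sup>t K\<^sub>s \<Phi>(t - s) ds\<close>. Applying \<open>K\<^sub>r\<close> to \<open>u(t - r)\<close>, exchanging
  it with the time integral and using \<open>K\<^sub>r K\<^sub>s = K\<^bsub>r+s\<^esub>\<close> merely removes the part \<open>[0, r]\<close> of the
  integration range. Thus \<open>r \<mapsto> K\<^sub>r u(t - r)\<close> is an indefinite integral of \<open>r \<mapsto> K\<^sub>r \<Phi>(t - r)\<close>.\<close>

lemma mild_flow_identity:
  fixes \<Phi> :: "real \<Rightarrow> 's \<Rightarrow> real" and f :: "'s \<Rightarrow> real"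
  assumes \<Phi>: "case_prod \<Phi> \<in> borel_measurable (borel \<Otimes>\<^sub>M S)"
      "\<And>s y. y \<in> space S \<Longrightarrow> \<bar>\<Phi> s y\<bar> \<le> B"
    and f: "f \<in> borel_measurable S" "\<And>y. y \<in> space S \<Longrightarrow> \<bar>f y\<bar> \<le> C"
    and r: "0 \<le> r" "r \<le> t" and z: "z \<in> space S"
  shows "(\<integral>y. ((\<integral>x. f x \<partial>K (t - r) y) - (LBINT s:{0..t - r}. \<integral>x. \<Phi> (t - r - s) x \<partial>K s y)) \<partial>K r z) =
         (\<integral>x. f x \<partial>K t z) - (LBINT q:{r..t}. \<integral>x. \<Phi> (t - q) x \<partial>K q z)"
proof -
  interpret prob_space "K r z" by (rule prob_space_kernel[OF z])
  interpret pair: pair_sigma_finite lborel "K r z" by unfold_locales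
  have \<Phi>s: "\<Phi> s \<in> borel_measurable S" for s
    using measurable_compose[OF measurable_Pair1' \<Phi>(1), of s] by simp
  define H where "H q = (\<integral>x. \<Phi> (t - q) x \<partial>K q z)" for q
  define G where "G s y = indicator {0..t - r} s * (\<integral>x. \<Phi> (t - r - s) x \<partial>K s y)" for s y
  have Gm: "case_prod G \<in> borel_measurable (borel \<Otimes>\<^sub>M S)"
    using borel_measurable_integral_kernel_time[OF \<Phi>(1), of "t - r"]
    unfolding G_def case_prod_beta' by measurable
  have Gb: "\<bar>G s y\<bar> \<le> B" if "s \<in> {0..t - r}" "y \<in> space S" for s y
    using abs_integral_kernel_le[OF \<Phi>s \<Phi>(2) that(2), of s "t - r - s"] that(1) by (simp add: G_def)
  have int: "integrable (lborel \<Otimes>\<^sub>M K r z) (case_prod G)"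
  proof (rule integrableI_bounded_set[where A="{0..t - r} \<times> space S" and B=B])
    show "case_prod G \<in> borel_measurable (lborel \<Otimes>\<^sub>M K r z)"
      using Gm measurable_cong_sets[OF sets_pair_measure_cong[OF sets_lborel sets_kernel[OF z]] refl] by blast
    show "emeasure (lborel \<Otimes>\<^sub>M K r z) ({0..t - r} \<times> space S) < \<infinity>"
      using r emeasure_space_1 emeasure_pair_measure_Times[of "{0..t - r}" lborel "space S"]
      by (simp add: sets_kernel[OF z] space_kernel[OF z])
    show "AE p in lborel \<Otimes>\<^sub>M K r z. p \<in> {0..t - r} \<times> space S \<longrightarrow> norm (case_prod G p) \<le> B"
      using Gb by (intro AE_I2) auto
    show "AE p in lborel \<Otimes>\<^sub>M K r z. p \<notin> {0..t - r} \<times> space S \<longrightarrow> case_prod G p = 0"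
      by (intro AE_I2) (auto simp: G_def indicator_def space_pair_measure space_kernel[OF z])
  qed (simp_all add: sets_kernel[OF z])
  have bind: "(\<integral>y. G s y \<partial>K r z) = indicator {r..t} (r + s) * H (r + s)" for s
    using integral_kernel_kernel[OF \<Phi>s \<Phi>(2) r(1) _ z, of s "t - r - s"]
    by (auto simp: G_def H_def indicator_def algebra_simps)
  have "(\<integral>y. (LBINT s:{0..t - r}. \<integral>x. \<Phi> (t - r - s) x \<partial>K s y) \<partial>K r z) = (\<integral>y. (\<integral>s. G s y \<partial>lborel) \<partial>K r z)"
    by (simp add: G_def set_lebesgue_integral_def)
  also have "\<dots> = (\<integral>s. (\<integral>y. G s y \<partial>K r z) \<partial>lborel)"
    by (rule pair.Fubini_integral[OF int])
  also have "\<dots> = (\<integral>s. indicator {r..t} (r + 1 * s) * H (r + 1 * s) \<partial>lborel)"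
    by (simp add: bind)
  also have "\<dots> = (LBINT q:{r..t}. H q)"
    using lborel_integral_real_affine[of 1 "\<lambda>q. indicator {r..t} q * H q" r] by (simp add: set_lebesgue_integral_def)
  finally have 1: "(\<integral>y. (LBINT s:{0..t - r}. \<integral>x. \<Phi> (t - r - s) x \<partial>K s y) \<partial>K r z) = (LBINT q:{r..t}. H q)" .
  have "(\<integral>y. (\<integral>x. f x \<partial>K (t - r) y) \<partial>K r z) = (\<integral>x. f x \<partial>K t z)"
    using integral_kernel_kernel[OF f r(1) _ z, of "t - r"] r by simp
  moreover have "integrable (K r z) (\<lambda>y. \<integral>x. f x \<partial>K (t - r) y)"
    using abs_integral_kernel_le[OF f] measurable_compose[OF measurable_kernel_section integral_measurable_subprob_algebra[OF f(1)]]
    by (intro integrable_kernel[where B=C] z) auto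
  moreover have "integrable (K r z) (\<lambda>y. LBINT s:{0..t - r}. \<integral>x. \<Phi> (t - r - s) x \<partial>K s y)"
    using pair.integrable_snd[OF int] by (simp add: G_def set_lebesgue_integral_def)
  ultimately show ?thesis using 1 by (simp add: H_def)
qed

end

section \<open>Explosion under the Osgood condition\<close>

text \<open>A convex function given with a choice \<open>p\<close> of slopes of its supporting lines. This form of
  convexity is what Jensen's inequality uses, and it makes monotonicity and local Lipschitz bounds
  immediate. On \<open>[c0, \<infinity>)\<close> the function is positive and its reciprocal integrable.\<close>

locale osgood_function =
  fixes \<psi> p :: "real \<Rightarrow> real" and c0 :: real
  assumes supporting_line: "0 \<le> c \<Longrightarrow> 0 \<le> l \<Longrightarrow> \<psi> c + p c * (l - c) \<le> \<psi> l"
    and zero: "\<psi> 0 = 0"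
    and c0_pos: "0 < c0"
    and psi_c0_pos: "0 < \<psi> c0"
    and integrable_inverse: "set_integrable lborel {c0..} (\<lambda>l. 1 / \<psi> l)"
begin

text \<open>The supporting line at a point \<open>a > 0\<close> with \<open>\<psi> a > 0\<close> passes below \<open>\<psi> 0 = 0\<close> at the origin, so its
  slope is positive.\<close>

lemma mono_beyond_c0:
  assumes "c0 \<le> c" "c \<le> l"
  shows "\<psi> c \<le> \<psi> l"
proof -
  have increasing: "\<psi> a \<le> \<psi> b" if "0 < a" "0 < \<psi> a" "a \<le> b" for a b
  proof -
    have "0 < p a * a" using supporting_line[of a 0] that zero by (simp add: algebra_simps)
    then have "0 \<le> p a * (b - a)" using that by (auto simp: zero_less_mult_iff)
    then show ?thesis using supporting_line[of a b] that by simp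
  qed
  have "0 < \<psi> c" using increasing[OF c0_pos psi_c0_pos assms(1)] psi_c0_pos by simp
  then show ?thesis using increasing[of c l] assms c0_pos by simp
qed

lemma pos_beyond_c0: "c0 \<le> c \<Longrightarrow> 0 < \<psi> c"
  using mono_beyond_c0[of c0 c] psi_c0_pos by simp

lemma slope_mono:
  assumes "0 \<le> a" "a \<le> b"
  shows "p a \<le> p b"
proof (cases "a = b")
  case False
  have "p a * (b - a) \<le> p b * (b - a)"
    using supporting_line[of a b] supporting_line[of b a] assms by (simp add: algebra_simps)
  then show ?thesis using False assms by simp
qed simp

text \<open>The explosion time of the solution of \<open>y' = \<psi>(y)\<close> that starts at \<open>c\<close>.\<close>

definition blow_up_time :: "real \<Rightarrow> real" where
  "blow_up_time c = (LBINT l:{c..}. 1 / \<psi> l)"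

lemma set_integrable_inverse:
  "A \<in> sets borel \<Longrightarrow> A \<subseteq> {c0..} \<Longrightarrow> set_integrable lborel A (\<lambda>l. 1 / \<psi> l)"
  by (rule set_integrable_subset[OF integrable_inverse]) auto

lemma blow_up_time_diff_ge:
  assumes "c0 \<le> x" "x \<le> y"
  shows "(y - x) / \<psi> y \<le> blow_up_time x - blow_up_time y"
proof -
  have "{x..} = {x..<y} \<union> {y..}" using assms by auto
  then have "blow_up_time x = (LBINT l:{x..<y}. 1 / \<psi> l) + blow_up_time y"
    unfolding blow_up_time_def using assms
    by (simp only:) (intro set_integral_Un set_integrable_inverse, auto)
  moreover have "(LBINT l:{x..<y}. 1 / \<psi> y) \<le> (LBINT l:{x..<y}. 1 / \<psi> l)"
    using assms pos_beyond_c0 mono_beyond_c0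
    by (intro set_integral_mono set_integrable_inverse) (auto intro!: divide_left_mono mult_pos_pos simp: set_integrable_def)
  moreover have "(LBINT l:{x..<y}. 1 / \<psi> y) = (y - x) / \<psi> y"
    using assms by (simp add: set_lebesgue_integral_def)
  ultimately show ?thesis by linarith
qed

lemma blow_up_time_antimono: "c0 \<le> x \<Longrightarrow> x \<le> y \<Longrightarrow> blow_up_time y \<le> blow_up_time x"
  using blow_up_time_diff_ge[of x y] pos_beyond_c0[of y] by (smt (verit) divide_nonneg_pos)

lemma blow_up_time_nonneg: "c0 \<le> x \<Longrightarrow> 0 \<le> blow_up_time x"
  unfolding blow_up_time_def set_lebesgue_integral_def
  using pos_beyond_c0 by (intro integral_nonneg_AE AE_I2) (auto simp: indicator_def less_imp_le)

lemma blow_up_time_tendsto_0: "(blow_up_time \<longlongrightarrow> 0) at_top"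
proof -
  have "((\<lambda>c. \<integral>l. indicator {c..} l * (1 / \<psi> l) * indicator {c0..} l \<partial>lborel) \<longlongrightarrow> (\<integral>l. 0 \<partial>(lborel :: real measure))) at_top"
  proof (rule integral_dominated_convergence_at_top[where w="\<lambda>l. indicator {c0..} l * (1 / \<psi> l)"])
    show i: "integrable lborel (\<lambda>l. indicator {c0..} l * (1 / \<psi> l))"
      using integrable_inverse by (simp add: set_integrable_def)
    have m: "(\<lambda>l. indicator {c..} l * (indicator {c0..} l * (1 / \<psi> l))) \<in> borel_measurable lborel" for c
      by (rule borel_measurable_times[OF _ borel_measurable_integrable[OF i]]) simp
    show "(\<lambda>l. indicator {c..} l * (1 / \<psi> l) * indicator {c0..} l) \<in> borel_measurable lborel" for c
      using m[of c] by (simp add: mult_ac)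
    show "AE l in lborel. ((\<lambda>c. indicator {c..} l * (1 / \<psi> l) * indicator {c0..} l) \<longlongrightarrow> 0) at_top"
    proof (rule AE_I2)
      fix l :: real
      have "eventually (\<lambda>c. indicator {c..} l * (1 / \<psi> l) * indicator {c0..} l = 0) at_top"
        using eventually_gt_at_top[of l] by eventually_elim simp
      then show "((\<lambda>c. indicator {c..} l * (1 / \<psi> l) * indicator {c0..} l) \<longlongrightarrow> 0) at_top"
        by (rule tendsto_eventually)
    qed
    show "\<forall>\<^sub>F c in at_top. AE l in lborel. norm (indicator {c..} l * (1 / \<psi> l) * indicator {c0..} l)
        \<le> indicator {c0..} l * (1 / \<psi> l)"
      using pos_beyond_c0 by (intro always_eventually allI AE_I2) (auto simp: indicator_def less_imp_le)
  qed auto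
  then have "((\<lambda>c. \<integral>l. indicator {c..} l * (1 / \<psi> l) * indicator {c0..} l \<partial>lborel) \<longlongrightarrow> 0) at_top"
    by simp
  moreover have "eventually (\<lambda>c. (\<integral>l. indicator {c..} l * (1 / \<psi> l) * indicator {c0..} l \<partial>lborel) = blow_up_time c) at_top"
    using eventually_ge_at_top[of c0]
  proof eventually_elim
    case (elim c)
    then show ?case unfolding blow_up_time_def set_lebesgue_integral_def
      by (intro Bochner_Integration.integral_cong) (auto simp: indicator_def)
  qed
  ultimately show ?thesis by (rule Lim_transform_eventually)
qed

text \<open>If \<open>U\<close> were differentiable, then \<open>U' \<ge> \<psi>(U)\<close> would say that \<open>blow_up_time (U r)\<close> decreases at
  least at rate \<open>1\<close>. Here the derivative \<open>W\<close> is only measurable. Instead of a chain rule, rate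
  \<open>1 / 2\<close> is shown on short intervals, over which \<open>\<psi> \<circ> U\<close> at most doubles, and the intervals are
  pieced together by \<open>Bolzano\<close>. The loss of a constant factor is harmless, as the
  blow-up time tends to \<open>0\<close>.\<close>

lemma time_le_blow_up_time:
  fixes U W :: "real \<Rightarrow> real"
  assumes t: "0 \<le> t"
    and W: "W \<in> borel_measurable borel" "\<And>q. \<bar>W q\<bar> \<le> B"
    and U: "\<And>r s. 0 \<le> r \<Longrightarrow> r \<le> s \<Longrightarrow> s \<le> t \<Longrightarrow> U s - U r = (LBINT q:{r..s}. W q)"
    and W_ge: "\<And>q. 0 \<le> q \<Longrightarrow> q \<le> t \<Longrightarrow> \<psi> (U q) \<le> W q"
    and start: "c0 < U 0"
  shows "t / 2 \<le> blow_up_time (U 0)"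
proof -
  have B: "0 \<le> B" using W(2)[of 0] by simp
  have Wi: "set_integrable lborel {r..s} W" for r s
    unfolding set_integrable_def
    using W by (intro integrableI_bounded_set_indicator[where B=B]) (auto simp: emeasure_lborel_Icc_eq)
  have ci: "set_integrable lborel {r..s} (\<lambda>_. m)" for r s m :: real
    unfolding set_integrable_def
    by (intro integrableI_bounded_set_indicator[where B="\<bar>m\<bar>"]) (auto simp: emeasure_lborel_Icc_eq)
  have Uge: "(s - r) * m \<le> U s - U r"
    if "0 \<le> r" "r \<le> s" "s \<le> t" "\<And>q. r \<le> q \<Longrightarrow> q < s \<Longrightarrow> m \<le> W q" for r s m
  proof -
    have "(s - r) * m = (LBINT q:{r..s}. m)" using that by (simp add: set_lebesgue_integral_def)
    also have "\<dots> \<le> (LBINT q:{r..s}. W q)"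
      unfolding set_lebesgue_integral_def
    proof (rule integral_mono_AE)
      show "integrable lborel (\<lambda>q. indicator {r..s} q *\<^sub>R m)"
        using ci by (simp add: set_integrable_def)
      show "integrable lborel (\<lambda>q. indicator {r..s} q *\<^sub>R W q)"
        using Wi by (simp add: set_integrable_def)
      show "AE q in lborel. indicator {r..s} q *\<^sub>R m \<le> indicator {r..s} q *\<^sub>R W q"
        using AE_lborel_singleton[of s] by eventually_elim (use that(4) in \<open>auto simp: indicator_def\<close>)
    qed
    also have "\<dots> = U s - U r" using U that by simp
    finally show ?thesis .
  qed
  have Ule: "U s - U r \<le> B * (s - r)" if "0 \<le> r" "r \<le> s" "s \<le> t" for r s
  proof -
    have "U s - U r \<le> (LBINT q:{r..s}. B)"
      unfolding U[OF that] using W(2) Wi ci by (intro set_integral_mono) (auto simp: abs_le_iff)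
    also have "\<dots> = B * (s - r)" using that by (simp add: set_lebesgue_integral_def)
    finally show ?thesis .
  qed
  have "B-lipschitz_on {0..t} U"
  proof (rule lipschitz_on_leI)
    fix x y assume xy: "x \<in> {0..t}" "y \<in> {0..t}" "x \<le> y"
    have "- B \<le> W q" for q using W(2)[of q] by (simp add: abs_le_iff)
    then have "(y - x) * - B \<le> U y - U x" using xy by (intro Uge) auto
    moreover have "U y - U x \<le> B * (y - x)" using xy by (intro Ule) auto
    ultimately have "\<bar>U y - U x\<bar> \<le> B * (y - x)" by (simp add: abs_le_iff algebra_simps)
    then show "dist (U x) (U y) \<le> B * dist x y" using xy by (simp add: dist_real_def abs_minus_commute)
  qed (rule B)
  then have cont: "continuous_on {0..t} U" by (rule lipschitz_on_continuous_on)
  have above: "c0 < U r" if r: "0 \<le> r" "r \<le> t" for r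
  proof (rule ccontr)
    assume "\<not> c0 < U r"
    \<comment> \<open>up to the first time when \<open>U \<le> c0\<close> the derivative \<open>W\<close> is nonnegative, so \<open>U\<close> cannot have come down from \<open>U 0\<close>\<close>
    define Z where "Z = {0..t} \<inter> U -` {..c0}"
    have "closed Z" unfolding Z_def by (rule continuous_closed_preimage[OF cont]) auto
    moreover have "bounded Z" by (rule bounded_subset[OF bounded_closed_interval[of 0 t]]) (auto simp: Z_def)
    ultimately have "compact Z" by (simp add: compact_eq_bounded_closed)
    moreover have "r \<in> Z" using r \<open>\<not> c0 < U r\<close> by (simp add: Z_def)
    ultimately obtain q where q: "q \<in> Z" "\<And>s. s \<in> Z \<Longrightarrow> q \<le> s"
      using compact_attains_inf[of Z] by (metis empty_iff)
    have "0 \<le> W s" if "0 \<le> s" "s < q" for s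
    proof -
      have "c0 < U s" using q(2)[of s] q(1) that by (fastforce simp: Z_def)
      then show ?thesis using pos_beyond_c0[of "U s"] W_ge[of s] that q(1) by (simp add: Z_def)
    qed
    then have "U 0 \<le> U q" using Uge[of 0 q 0] q(1) by (simp add: Z_def)
    then show False using start q(1) by (simp add: Z_def)
  qed
  have mono: "U r \<le> U s" if "0 \<le> r" "r \<le> s" "s \<le> t" for r s
  proof -
    have "0 \<le> W q" if "r \<le> q" "q < s" for q
      using W_ge[of q] pos_beyond_c0[of "U q"] above[of q] that \<open>0 \<le> r\<close> \<open>s \<le> t\<close> by simp
    then show ?thesis using Uge[of r s 0] that by simp
  qed
  define k where "k = \<bar>p (U t)\<bar> + 1"
  define P where "P a b \<longleftrightarrow> (0 \<le> a \<and> b \<le> t \<longrightarrow> (b - a) / 2 \<le> blow_up_time (U a) - blow_up_time (U b))" for a b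
  have "P 0 t"
    using t
  proof (induction rule: Bolzano)
    case (trans a b c) then show ?case by (auto simp: P_def)
  next
    case (local x)
    \<comment> \<open>\<open>k\<close> bounds the slope of \<open>\<psi>\<close> on the range of \<open>U\<close>, and \<open>B\<close> that of \<open>U\<close>: within time \<open>d\<close>, \<open>\<psi> \<circ> U\<close> gains at most \<open>\<psi> c0 \<le> \<psi> (U a)\<close>\<close>
    define d where "d = \<psi> c0 / (k * (B + 1))"
    have d: "0 < d" unfolding d_def k_def using psi_c0_pos B by (intro divide_pos_pos mult_pos_pos) auto
    have "(b - a) / 2 \<le> blow_up_time (U a) - blow_up_time (U b)"
      if ab: "a \<le> x" "x \<le> b" "b - a < d" "0 \<le> a" "b \<le> t" for a b
    proof -
      have Ua: "\<psi> c0 \<le> \<psi> (U a)" "0 < \<psi> (U a)"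
        using mono_beyond_c0[of c0 "U a"] pos_beyond_c0[of "U a"] above[of a] ab by auto
      have Ub: "0 < \<psi> (U b)" using pos_beyond_c0[of "U b"] above[of b] ab by auto
      have UaUb: "U a \<le> U b" using mono ab by auto
      have "\<psi> (U b) - \<psi> (U a) \<le> p (U b) * (U b - U a)"
        using supporting_line[of "U b" "U a"] above[of a] above[of b] c0_pos ab by (simp add: algebra_simps)
      also have "\<dots> \<le> k * (U b - U a)"
        using slope_mono[of "U b" "U t"] mono[of b t] above[of b] c0_pos ab UaUb
        by (intro mult_right_mono) (auto simp: k_def)
      also have "\<dots> \<le> k * ((B + 1) * (b - a))"
        using Ule[of a b] ab by (intro mult_left_mono) (auto simp: k_def algebra_simps)
      also have "\<dots> \<le> k * ((B + 1) * d)"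
        using ab B by (intro mult_left_mono) (auto simp: k_def)
      also have "\<dots> = \<psi> c0" using B by (simp add: d_def k_def)
      finally have le2: "\<psi> (U b) \<le> 2 * \<psi> (U a)" using Ua by simp
      have "(b - a) * \<psi> (U a) \<le> U b - U a"
      proof (rule Uge)
        show "\<psi> (U a) \<le> W q" if "a \<le> q" "q < b" for q
          using mono_beyond_c0[of "U a" "U q"] above[of a] mono[of a q] W_ge[of q] ab that by auto
      qed (use ab in auto)
      then have "(b - a) * \<psi> (U a) / \<psi> (U b) \<le> (U b - U a) / \<psi> (U b)"
        using Ub by (simp add: divide_right_mono)
      also have "\<dots> \<le> blow_up_time (U a) - blow_up_time (U b)"
        using blow_up_time_diff_ge above[of a] UaUb ab by auto
      finally have *: "(b - a) * (\<psi> (U a) / \<psi> (U b)) \<le> blow_up_time (U a) - blow_up_time (U b)" by simp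
      have "(b - a) * (1 / 2) \<le> (b - a) * (\<psi> (U a) / \<psi> (U b))"
        using le2 Ub ab by (intro mult_left_mono) (auto simp: field_simps)
      then show ?thesis using * by linarith
    qed
    then show ?case using d unfolding P_def by (intro exI[of _ d]) simp
  qed
  then show ?thesis using blow_up_time_nonneg[of "U t"] above[of t] t by (simp add: P_def)
qed

end

context measurable_markov_semigroup
begin

text \<open>If \<open>u t z > c\<close>, then \<open>U(r) = \<integral> u(t - r) dK\<^sub>r(z)\<close> starts above \<open>c\<close> and would explode before time \<open>t\<close>.
  Jensen's inequality, by the supporting line at the mean \<open>U(q)\<close>, gives \<open>\<psi>(U(q)) \<le> W(q)\<close>.\<close>

lemma mild_solution_le:
  fixes \<Phi> u :: "real \<Rightarrow> 's \<Rightarrow> real" and f :: "'s \<Rightarrow> real"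
  assumes \<psi>: "osgood_function \<psi> p c0"
    and \<Phi>: "case_prod \<Phi> \<in> borel_measurable (borel \<Otimes>\<^sub>M S)"
      "\<And>s y. y \<in> space S \<Longrightarrow> \<bar>\<Phi> s y\<bar> \<le> B"
    and f: "f \<in> borel_measurable S" "\<And>y. y \<in> space S \<Longrightarrow> \<bar>f y\<bar> \<le> C"
    and u: "\<And>r. 0 \<le> r \<Longrightarrow> r \<le> t \<Longrightarrow> u r \<in> borel_measurable S"
      "\<And>r y. 0 \<le> r \<Longrightarrow> r \<le> t \<Longrightarrow> y \<in> space S \<Longrightarrow> 0 \<le> u r y"
      "\<And>r y. 0 \<le> r \<Longrightarrow> r \<le> t \<Longrightarrow> y \<in> space S \<Longrightarrow> u r y \<le> A"
    and mild: "\<And>r y. 0 \<le> r \<Longrightarrow> r \<le> t \<Longrightarrow> y \<in> space S \<Longrightarrow>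
        u r y = (\<integral>x. f x \<partial>K r y) - (LBINT s:{0..r}. \<integral>x. \<Phi> (r - s) x \<partial>K s y)"
    and ge: "\<And>r y. 0 \<le> r \<Longrightarrow> r \<le> t \<Longrightarrow> y \<in> space S \<Longrightarrow> \<psi> (u r y) \<le> \<Phi> r y"
    and z: "z \<in> space S" and t: "0 \<le> t"
    and c: "c0 \<le> c" "osgood_function.blow_up_time \<psi> c < t / 2"
  shows "u t z \<le> c"
proof (rule ccontr)
  interpret osgood_function \<psi> p c0 by fact
  assume contra: "\<not> u t z \<le> c"
  define W where "W q = (\<integral>x. \<Phi> (t - q) x \<partial>K q z)" for q
  define U where "U r = (\<integral>y. u (t - r) y \<partial>K r z)" for r
  have \<Phi>s: "\<Phi> s \<in> borel_measurable S" for s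
    using measurable_compose[OF measurable_Pair1' \<Phi>(1), of s] by simp
  have Wm: "W \<in> borel_measurable borel"
    using measurable_compose[OF measurable_Pair2'[OF z] borel_measurable_integral_kernel_time[OF \<Phi>(1), of t]]
    by (simp add: W_def[abs_def])
  have Wb: "\<bar>W q\<bar> \<le> B" for q
    unfolding W_def by (rule abs_integral_kernel_le[OF \<Phi>s \<Phi>(2) z])
  have U_eq: "U r = (\<integral>x. f x \<partial>K t z) - (LBINT q:{r..t}. W q)" if "0 \<le> r" "r \<le> t" for r
  proof -
    have "U r = (\<integral>y. ((\<integral>x. f x \<partial>K (t - r) y) - (LBINT s:{0..t - r}. \<integral>x. \<Phi> (t - r - s) x \<partial>K s y)) \<partial>K r z)"
      unfolding U_def using that mild by (intro Bochner_Integration.integral_cong) (auto simp: space_kernel[OF z])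
    then show ?thesis unfolding W_def using mild_flow_identity[OF \<Phi> f that z] by simp
  qed
  have Wi: "set_integrable lborel {r..s} W" for r s
    unfolding set_integrable_def
    using Wm Wb by (intro integrableI_bounded_set_indicator[where B=B]) (auto simp: emeasure_lborel_Icc_eq)
  have Wsplit: "(LBINT q:{r..t}. W q) = (LBINT q:{r..s}. W q) + (LBINT q:{s..t}. W q)"
    if "r \<le> s" "s \<le> t" for r s
  proof -
    have "AE q in lborel. \<not> (q \<in> {r..s} \<and> q \<in> {s..t})"
      using AE_lborel_singleton[of s] by eventually_elim auto
    moreover have "{r..t} = {r..s} \<union> {s..t}" using that by auto
    ultimately show ?thesis
      using set_integral_Un_AE[of "{r..s}" "{s..t}" lborel W] Wi by simp
  qed
  have U0: "U 0 = u t z"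
    using U_eq[of 0] mild[of t z] t z by (simp add: W_def)
  have "t / 2 \<le> blow_up_time (U 0)"
  proof (rule time_le_blow_up_time[OF t Wm Wb])
    show "U s - U r = (LBINT q:{r..s}. W q)" if "0 \<le> r" "r \<le> s" "s \<le> t" for r s
      using U_eq[of s] U_eq[of r] Wsplit[of r s] that by simp
    show "c0 < U 0" using contra c U0 by simp
    show "\<psi> (U q) \<le> W q" if q: "0 \<le> q" "q \<le> t" for q
    proof -
      interpret prob_space "K q z" by (rule prob_space_kernel[OF z])
      have uq: "0 \<le> t - q" "t - q \<le> t" using q by auto
      have iu: "integrable (K q z) (u (t - q))"
        using u[OF uq] z by (intro integrable_kernel[where B=A]) auto
      have U0': "0 \<le> U q" unfolding U_def
        using u(2)[OF uq] by (intro integral_nonneg_AE AE_I2) (auto simp: space_kernel[OF z])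
      have "\<psi> (U q) = (\<integral>y. \<psi> (U q) + p (U q) * (u (t - q) y - U q) \<partial>K q z)"
        using iu by (simp add: U_def prob_space)
      also have "\<dots> \<le> W q" unfolding W_def
      proof (rule integral_mono)
        show "integrable (K q z) (\<lambda>y. \<psi> (U q) + p (U q) * (u (t - q) y - U q))" using iu by simp
        show "integrable (K q z) (\<Phi> (t - q))" by (rule integrable_kernel[OF \<Phi>s \<Phi>(2) z])
        fix y assume "y \<in> space (K q z)"
        then have y: "y \<in> space S" by (simp add: space_kernel[OF z])
        have "\<psi> (U q) + p (U q) * (u (t - q) y - U q) \<le> \<psi> (u (t - q) y)"
          by (rule supporting_line[OF U0' u(2)[OF uq y]])
        also have "\<dots> \<le> \<Phi> (t - q) y" by (rule ge[OF uq y])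
        finally show "\<psi> (U q) + p (U q) * (u (t - q) y - U q) \<le> \<Phi> (t - q) y" .
      qed
      finally show ?thesis .
    qed
  qed
  also have "\<dots> \<le> blow_up_time c"
    using contra c U0 by (intro blow_up_time_antimono) auto
  finally show False using c by simp
qed

end

section \<open>Branching mechanisms\<close>

definition compensated_exp :: "real \<Rightarrow> real \<Rightarrow> real" where
  "compensated_exp l y = exp (- l * y) - 1 + l * y"

lemma compensated_exp_nonneg: "0 \<le> compensated_exp l y"
  using exp_ge_add_one_self[of "- l * y"] by (simp add: compensated_exp_def)

text \<open>With \<open>z = l y\<close> the left-hand side is at most \<open>z\<close> and, by \<open>exp (- z) \<le> 1 / (1 + z) \<le> 1 - z + z\<^sup>2\<close>,
  also at most \<open>z\<^sup>2\<close>.\<close>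

lemma compensated_exp_le:
  assumes "0 \<le> l" "0 < y"
  shows "compensated_exp l y \<le> (l + l\<^sup>2) * min y (y\<^sup>2)"
proof -
  define z where "z = l * y"
  have z: "0 \<le> z" using assms by (simp add: z_def)
  have "exp (- z) \<le> 1 / (1 + z)"
    using exp_ge_add_one_self[of z] z by (simp add: exp_minus field_simps)
  also have "\<dots> \<le> 1 - z + z\<^sup>2"
  proof -
    have "(1 + z) * (1 - z + z\<^sup>2) = 1 + z ^ 3" by (simp add: algebra_simps power2_eq_square power3_eq_cube)
    then show ?thesis using z by (simp add: pos_divide_le_eq mult.commute)
  qed
  finally have "compensated_exp l y \<le> l\<^sup>2 * y\<^sup>2"
    by (simp add: compensated_exp_def z_def power_mult_distrib)
  also have "\<dots> \<le> (l + l\<^sup>2) * y\<^sup>2" using assms by (intro mult_right_mono) auto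
  finally have 1: "compensated_exp l y \<le> (l + l\<^sup>2) * y\<^sup>2" .
  have "compensated_exp l y \<le> l * y" using z by (simp add: compensated_exp_def z_def)
  also have "\<dots> \<le> (l + l\<^sup>2) * y" using assms by (intro mult_right_mono) auto
  finally show ?thesis using 1 by (simp add: min_def)
qed

lemma compensated_exp_supporting_line:
  "compensated_exp c y + y * (1 - exp (- c * y)) * (l - c) \<le> compensated_exp l y"
proof -
  have "exp (- c * y) * (1 + (c - l) * y) \<le> exp (- c * y) * exp ((c - l) * y)"
    using exp_ge_add_one_self[of "(c - l) * y"] by (intro mult_left_mono) auto
  also have "\<dots> = exp (- l * y)" by (simp add: exp_add[symmetric] algebra_simps)
  finally show ?thesis by (simp add: compensated_exp_def algebra_simps)
qed

lemma slope_integrand_bounds: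
  fixes c y :: real
  assumes "0 \<le> c" "0 < y"
  shows "0 \<le> y * (1 - exp (- c * y))" "y * (1 - exp (- c * y)) \<le> (1 + c) * min y (y\<^sup>2)"
proof -
  have cy: "0 \<le> c * y" using assms by simp
  then show "0 \<le> y * (1 - exp (- c * y))" using assms by simp
  have "1 - exp (- c * y) \<le> c * y" using exp_ge_add_one_self[of "- c * y"] by simp
  then have "y * (1 - exp (- c * y)) \<le> y * (c * y)" using assms by (intro mult_left_mono) auto
  also have "\<dots> \<le> (1 + c) * y\<^sup>2" by (simp add: power2_eq_square algebra_simps)
  finally have "y * (1 - exp (- c * y)) \<le> (1 + c) * y\<^sup>2" .
  moreover have "y * (1 - exp (- c * y)) \<le> (1 + c) * y"
  proof -
    have "y * (1 - exp (- c * y)) \<le> y" using assms by (simp add: mult_le_cancel_left2)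
    also have "\<dots> \<le> (1 + c) * y" using cy by (simp add: algebra_simps)
    finally show ?thesis .
  qed
  ultimately show "y * (1 - exp (- c * y)) \<le> (1 + c) * min y (y\<^sup>2)" by (simp add: min_def)
qed

text \<open>The derivative of \<open>branching_fun b a \<eta>\<close> at \<open>c\<close>.\<close>

definition branching_slope :: "real \<Rightarrow> real \<Rightarrow> real measure \<Rightarrow> real \<Rightarrow> real" where
  "branching_slope b a \<eta> c = - b + 2 * a * c + (\<integral>y. y * (1 - exp (- c * y)) \<partial>\<eta>)"

locale jump_measure =
  fixes \<eta> :: "real measure"
  assumes sets_eta: "sets \<eta> = sets positive_borel"
    and finite_moment: "(\<integral>\<^sup>+y. ennreal (min y (y\<^sup>2)) \<partial>\<eta>) < \<infinity>"
begin

lemma space_eta: "space \<eta> = {0<..}"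
  using sets_eq_imp_space_eq[OF sets_eta] by (simp add: space_restrict_space)

lemma borel_measurable_eta:
  fixes f :: "real \<Rightarrow> real"
  shows "f \<in> borel_measurable borel \<Longrightarrow> f \<in> borel_measurable \<eta>"
  by (simp add: measurable_cong_sets[OF sets_eta refl] measurable_restrict_space1)

lemma integrable_min: "integrable \<eta> (\<lambda>y. min y (y\<^sup>2))"
  using finite_moment by (intro integrableI_nonneg borel_measurable_eta AE_I2) (auto simp: space_eta)

lemma integrable_dominated:
  fixes g :: "real \<Rightarrow> real"
  assumes "g \<in> borel_measurable borel" "\<And>y. 0 < y \<Longrightarrow> 0 \<le> g y" "\<And>y. 0 < y \<Longrightarrow> g y \<le> C * min y (y\<^sup>2)"
  shows "integrable \<eta> g"
proof (rule Bochner_Integration.integrable_bound)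
  show "integrable \<eta> (\<lambda>y. C * min y (y\<^sup>2))" using integrable_min by simp
  show "AE y in \<eta>. norm (g y) \<le> norm (C * min y (y\<^sup>2))"
    using assms(2,3) by (intro AE_I2) (fastforce simp: space_eta)
qed (rule borel_measurable_eta[OF assms(1)])

lemma integrable_compensated_exp: "0 \<le> l \<Longrightarrow> integrable \<eta> (compensated_exp l)"
  using compensated_exp_nonneg compensated_exp_le
  by (intro integrable_dominated[where C="l + l\<^sup>2"]) (auto simp: compensated_exp_def[abs_def])

lemma branching_fun_eq: "branching_fun b a \<eta> l = - b * l + a * l\<^sup>2 + (\<integral>y. compensated_exp l y \<partial>\<eta>)"
  by (simp add: branching_fun_def compensated_exp_def)

text \<open>Each of the three parts of the branching mechanism lies above its tangents; for the jump part this is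
  \<open>compensated_exp_supporting_line\<close>, integrated.\<close>

lemma branching_fun_supporting_line:
  assumes "0 \<le> a" "0 \<le> c" "0 \<le> l"
  shows "branching_fun b a \<eta> c + branching_slope b a \<eta> c * (l - c) \<le> branching_fun b a \<eta> l"
proof -
  let ?k = "\<lambda>y. y * (1 - exp (- c * y))"
  have ik: "integrable \<eta> ?k"
    using slope_integrand_bounds[OF assms(2)] by (intro integrable_dominated[where C="1 + c"]) auto
  note ih = integrable_compensated_exp[OF assms(2)] integrable_compensated_exp[OF assms(3)]
  have "(\<integral>y. compensated_exp c y \<partial>\<eta>) + (\<integral>y. ?k y \<partial>\<eta>) * (l - c) = (\<integral>y. compensated_exp c y + ?k y * (l - c) \<partial>\<eta>)"
    using ih ik by simp
  also have "\<dots> \<le> (\<integral>y. compensated_exp l y \<partial>\<eta>)"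
    using ih ik by (intro integral_mono) (auto intro!: compensated_exp_supporting_line[simplified])
  finally have 1: "(\<integral>y. compensated_exp c y \<partial>\<eta>) + (\<integral>y. ?k y \<partial>\<eta>) * (l - c) \<le> (\<integral>y. compensated_exp l y \<partial>\<eta>)" .
  have "0 \<le> a * (l - c)\<^sup>2" using assms by simp
  then have "a * c\<^sup>2 + 2 * a * c * (l - c) \<le> a * l\<^sup>2" by (simp add: power2_eq_square algebra_simps)
  then show ?thesis using 1 unfolding branching_fun_eq branching_slope_def by (simp add: algebra_simps)
qed

lemma abs_branching_fun_le:
  assumes l: "0 \<le> l" "l \<le> A"
    and K: "(\<integral>\<^sup>+y. ennreal (min y (y\<^sup>2)) \<partial>\<eta>) \<le> ennreal K" "0 \<le> K"
  shows "\<bar>branching_fun b a \<eta> l\<bar> \<le> \<bar>b\<bar> * A + \<bar>a\<bar> * A\<^sup>2 + (A + A\<^sup>2) * K"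
proof -
  have "(\<integral>y. min y (y\<^sup>2) \<partial>\<eta>) = enn2real (\<integral>\<^sup>+y. ennreal (min y (y\<^sup>2)) \<partial>\<eta>)"
    by (rule integral_eq_nn_integral) (auto intro!: borel_measurable_eta AE_I2 simp: space_eta)
  then have min: "(\<integral>y. min y (y\<^sup>2) \<partial>\<eta>) \<le> K"
    using K enn2real_mono[OF K(1)] by simp
  have "(\<integral>y. compensated_exp l y \<partial>\<eta>) \<le> (\<integral>y. (l + l\<^sup>2) * min y (y\<^sup>2) \<partial>\<eta>)"
    using integrable_compensated_exp[OF l(1)] integrable_min compensated_exp_le[OF l(1)]
    by (intro integral_mono) (auto simp: space_eta)
  also have "\<dots> \<le> (l + l\<^sup>2) * K" using min l by (simp add: mult_left_mono)
  also have "\<dots> \<le> (A + A\<^sup>2) * K" using l K by (intro mult_right_mono add_mono power_mono) auto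
  finally have 1: "(\<integral>y. compensated_exp l y \<partial>\<eta>) \<le> (A + A\<^sup>2) * K" .
  have 2: "0 \<le> (\<integral>y. compensated_exp l y \<partial>\<eta>)"
    by (intro integral_nonneg_AE AE_I2 compensated_exp_nonneg)
  have "\<bar>- b * l\<bar> \<le> \<bar>b\<bar> * A" using l by (simp add: abs_mult mult_left_mono)
  moreover have "\<bar>a * l\<^sup>2\<bar> \<le> \<bar>a\<bar> * A\<^sup>2" using l by (simp add: abs_mult mult_left_mono power_mono)
  ultimately show ?thesis unfolding branching_fun_eq using 1 2 by linarith
qed

lemma tendsto_integral_compensated_exp:
  assumes "\<And>n. 0 \<le> X n" "X \<longlonglongrightarrow> s" "0 \<le> s"
  shows "(\<lambda>n. \<integral>y. compensated_exp (X n) y \<partial>\<eta>) \<longlonglongrightarrow> (\<integral>y. compensated_exp s y \<partial>\<eta>)"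
proof -
  obtain A where A: "\<And>n. \<bar>X n\<bar> \<le> A"
    using convergent_imp_Bseq[OF convergentI[OF assms(2)]] by (auto simp: Bseq_def)
  show ?thesis
  proof (rule integral_dominated_convergence[where w="\<lambda>y. (A + A\<^sup>2) * min y (y\<^sup>2)"])
    show "integrable \<eta> (\<lambda>y. (A + A\<^sup>2) * min y (y\<^sup>2))" using integrable_min by simp
    show "AE y in \<eta>. (\<lambda>n. compensated_exp (X n) y) \<longlonglongrightarrow> compensated_exp s y"
      unfolding compensated_exp_def by (intro AE_I2 tendsto_intros assms)
    show "AE y in \<eta>. norm (compensated_exp (X n) y) \<le> (A + A\<^sup>2) * min y (y\<^sup>2)" for n
    proof (rule AE_I2)
      fix y assume "y \<in> space \<eta>"
      then have y: "0 < y" by (simp add: space_eta)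
      have "compensated_exp (X n) y \<le> (X n + (X n)\<^sup>2) * min y (y\<^sup>2)"
        by (rule compensated_exp_le[OF assms(1) y])
      also have "\<dots> \<le> (A + A\<^sup>2) * min y (y\<^sup>2)"
        using A[of n] assms(1)[of n] y by (intro mult_right_mono add_mono power_mono) auto
      finally show "norm (compensated_exp (X n) y) \<le> (A + A\<^sup>2) * min y (y\<^sup>2)"
        using compensated_exp_nonneg[of "X n" y] by simp
    qed
  qed (use integrable_compensated_exp assms in \<open>auto intro: borel_measurable_integrable\<close>)
qed

text \<open>Divergence of the mechanism at infinity supplies a point beyond which it is positive; any point
  beyond both that one and \<open>c\<close> serves as \<open>c0\<close>.\<close>

lemma osgood_branching_fun:
  assumes "0 \<le> a" "filterlim (branching_fun b a \<eta>) at_top at_top"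
    and c: "0 < c" "set_integrable lborel {c..} (\<lambda>l. 1 / branching_fun b a \<eta> l)"
  obtains c0 where "osgood_function (branching_fun b a \<eta>) (branching_slope b a \<eta>) c0"
proof -
  have "eventually (\<lambda>l. 0 < branching_fun b a \<eta> l) at_top"
    using assms(2) by (auto simp: filterlim_at_top_dense)
  then obtain c' where c': "\<And>l. c' \<le> l \<Longrightarrow> 0 < branching_fun b a \<eta> l"
    by (auto simp: eventually_at_top_linorder)
  have "osgood_function (branching_fun b a \<eta>) (branching_slope b a \<eta>) (max c c')"
  proof
    show "branching_fun b a \<eta> 0 = 0" by (simp add: branching_fun_def)
    show "set_integrable lborel {max c c'..} (\<lambda>l. 1 / branching_fun b a \<eta> l)"
      by (rule set_integrable_subset[OF c(2)]) auto
  qed (use c(1) c' branching_fun_supporting_line[OF assms(1)] in auto)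
  then show thesis by (rule that)
qed

end

text \<open>The jump kernel may consist of infinite measures, so it is not a kernel into the
  subprobability measures.\<close>

lemma borel_measurable_nn_integral_general_kernel:
  assumes \<kappa>: "kernel A B \<kappa>" and f: "f \<in> borel_measurable B"
  shows "(\<lambda>x. \<integral>\<^sup>+y. f y \<partial>\<kappa> x) \<in> borel_measurable A"
proof -
  have sets: "sets (\<kappa> x) = sets B" if "x \<in> space A" for x using \<kappa> that by (simp add: kernel_def)
  have meas: "g \<in> borel_measurable (\<kappa> x)" if "g \<in> borel_measurable B" "x \<in> space A" for g :: "_ \<Rightarrow> ennreal" and x
    using that by (simp add: measurable_cong_sets[OF sets refl])
  show ?thesis using f
  proof induct
    case (cong f g)
    have "?case \<longleftrightarrow> (\<lambda>x. \<integral>\<^sup>+y. g y \<partial>\<kappa> x) \<in> borel_measurable A"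
      using cong(3) sets_eq_imp_space_eq[OF sets] by (intro measurable_cong nn_integral_cong) simp
    with cong(4) show ?case by simp
  next
    case (set C)
    have "(\<lambda>x. emeasure (\<kappa> x) C) \<in> borel_measurable A" using \<kappa> set by (simp add: kernel_def)
    also have "?this \<longleftrightarrow> ?case" using set sets by (intro measurable_cong) simp
    finally show ?case .
  next
    case (mult g c)
    then have "(\<lambda>x. \<integral>\<^sup>+y. c * g y \<partial>\<kappa> x) \<in> borel_measurable A \<longleftrightarrow>
        (\<lambda>x. c * (\<integral>\<^sup>+y. g y \<partial>\<kappa> x)) \<in> borel_measurable A"
      by (intro measurable_cong nn_integral_cmult meas)
    with mult show ?case by simp
  next
    case (add g h)
    then have "(\<lambda>x. \<integral>\<^sup>+y. g y + h y \<partial>\<kappa> x) \<in> borel_measurable A \<longleftrightarrow>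
        (\<lambda>x. (\<integral>\<^sup>+y. g y \<partial>\<kappa> x) + (\<integral>\<^sup>+y. h y \<partial>\<kappa> x)) \<in> borel_measurable A"
      by (intro measurable_cong nn_integral_add meas)
    with add show ?case by (simp add: ac_simps)
  next
    case (seq g)
    then have "(\<lambda>x. \<integral>\<^sup>+y. (SUP i. g i) y \<partial>\<kappa> x) \<in> borel_measurable A \<longleftrightarrow>
        (\<lambda>x. SUP i. (\<integral>\<^sup>+y. g i y \<partial>\<kappa> x)) \<in> borel_measurable A"
      unfolding SUP_apply by (intro measurable_cong nn_integral_monotone_convergence_SUP meas)
    with seq show ?case by (simp add: ac_simps)
  qed
qed

context branching_mechanism
begin

abbreviation mechanism :: "'a \<Rightarrow> real \<Rightarrow> real" where
  "mechanism x l \<equiv> branching_fun (\<beta> x) (\<alpha> x) (\<pi> x) l"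

lemma jump_measure_pi: "jump_measure (\<pi> x)"
proof
  show "sets (\<pi> x) = sets positive_borel" using pi_kernel by (simp add: kernel_def)
  show "(\<integral>\<^sup>+y. ennreal (min y (y\<^sup>2)) \<partial>\<pi> x) < \<infinity>"
    using pi_bounded by (rule le_less_trans[rotated]) (rule SUP_upper, simp)
qed

lemma mechanism_locally_bounded:
  obtains B where "\<And>x l. 0 \<le> l \<Longrightarrow> l \<le> A \<Longrightarrow> \<bar>mechanism x l\<bar> \<le> B"
proof (cases "0 \<le> A")
  case True
  have "bounded (range \<beta>)" "bounded (range \<alpha>)"
    using beta alpha by (auto simp: bounded_borel_def nonneg_bounded_borel_def)
  then obtain b a where "\<forall>y\<in>range \<beta>. norm y \<le> b" "\<forall>y\<in>range \<alpha>. norm y \<le> a"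
    unfolding bounded_iff by blast
  then have b: "\<bar>\<beta> x\<bar> \<le> b" and a: "\<bar>\<alpha> x\<bar> \<le> a" for x by auto
  define K where "K = enn2real (SUP x. \<integral>\<^sup>+y. ennreal (min y (y\<^sup>2)) \<partial>\<pi> x)"
  have K: "(\<integral>\<^sup>+y. ennreal (min y (y\<^sup>2)) \<partial>\<pi> x) \<le> ennreal K" for x
    using pi_bounded unfolding K_def by (subst ennreal_enn2real) (auto intro: SUP_upper)
  show thesis
  proof
    fix x l assume l: "0 \<le> l" "l \<le> A"
    have "\<bar>mechanism x l\<bar> \<le> \<bar>\<beta> x\<bar> * A + \<bar>\<alpha> x\<bar> * A\<^sup>2 + (A + A\<^sup>2) * K"
      by (rule jump_measure.abs_branching_fun_le[OF jump_measure_pi l K]) (simp add: K_def)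
    also have "\<dots> \<le> b * A + a * A\<^sup>2 + (A + A\<^sup>2) * K"
      using a b True by (intro add_mono mult_right_mono order_refl) auto
    finally show "\<bar>mechanism x l\<bar> \<le> b * A + a * A\<^sup>2 + (A + A\<^sup>2) * K" .
  qed
next
  case False
  then show thesis by (intro that[of 0]) auto
qed

text \<open>Joint measurability in \<open>(l, x)\<close> again comes from right continuity, this time in \<open>l\<close>.\<close>

lemma borel_measurable_mechanism:
  "(\<lambda>(l, x). mechanism x (max 0 l)) \<in> borel_measurable (borel \<Otimes>\<^sub>M borel)"
proof (rule borel_measurable_right_continuous_family)
  have bm: "\<beta> \<in> borel_measurable borel" and am: "\<alpha> \<in> borel_measurable borel"
    using beta alpha by (auto simp: bounded_borel_def nonneg_bounded_borel_def)
  show "(\<lambda>x. mechanism x l) \<in> borel_measurable borel" if l: "0 \<le> l" for l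
  proof -
    have "(\<lambda>y. ennreal (compensated_exp l y)) \<in> borel_measurable positive_borel"
      by (intro measurable_restrict_space1) (simp add: compensated_exp_def)
    then have "(\<lambda>x. enn2real (\<integral>\<^sup>+y. ennreal (compensated_exp l y) \<partial>\<pi> x)) \<in> borel_measurable borel"
      by (intro borel_measurable_enn2real borel_measurable_nn_integral_general_kernel[OF pi_kernel])
    moreover have "(\<integral>y. compensated_exp l y \<partial>\<pi> x) = enn2real (\<integral>\<^sup>+y. ennreal (compensated_exp l y) \<partial>\<pi> x)" for x
      using jump_measure.integrable_compensated_exp[OF jump_measure_pi l]
      by (intro integral_eq_nn_integral AE_I2 compensated_exp_nonneg) auto
    ultimately show ?thesis
      using bm am by (simp add: jump_measure.branching_fun_eq[OF jump_measure_pi])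
  qed
  show "(\<lambda>n. mechanism x (X n)) \<longlonglongrightarrow> mechanism x s"
    if "0 \<le> s" "\<And>n. s < X n" "X \<longlonglongrightarrow> s" for s x X
    unfolding jump_measure.branching_fun_eq[OF jump_measure_pi]
  proof (intro tendsto_intros jump_measure.tendsto_integral_compensated_exp[OF jump_measure_pi] that)
    show "0 \<le> X n" for n using that(1) that(2)[of n] by simp
  qed
qed

end

section \<open>Bounds on the cumulant semigroup and extinction\<close>

text \<open>Functions on \<open>E\<close> are extended by \<open>0\<close> to the cemetery. The killed process thereby becomes an honest one,
  whose transition kernels are probability measures. A jointly measurable family on \<open>E\<close> stays jointly
  measurable under this extension.\<close>

lemma borel_measurable_case_option:
  fixes f :: "'i \<Rightarrow> 'a::topological_space \<Rightarrow> real"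
  assumes f: "case_prod f \<in> borel_measurable (A \<Otimes>\<^sub>M borel)"
  shows "(\<lambda>(i, z). case_option 0 (f i) z) \<in> borel_measurable (A \<Otimes>\<^sub>M borel_of cemetery_topology)"
proof -
  define g :: "'a option \<Rightarrow> 'a" where "g z = (case z of None \<Rightarrow> undefined | Some y \<Rightarrow> y)" for z
  have g: "g \<in> measurable (borel_of cemetery_topology) borel"
  proof (rule borel_measurableI)
    fix U :: "'a set" assume "open U"
    then have "openin cemetery_topology (g -` U)"
      by (simp add: openin_cemetery_topology g_def vimage_def)
    then show "g -` U \<inter> space (borel_of cemetery_topology) \<in> sets (borel_of cemetery_topology)"
      by (simp add: sets_borel_of sigma_sets.Basic)
  qed
  have none: "{None} \<in> sets (borel_of cemetery_topology)"
    by (simp add: sets_borel_of openin_cemetery_topology sigma_sets.Basic vimage_def)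
  have "(\<lambda>p. if snd p = None then 0 else case_prod f (fst p, g (snd p)))
      \<in> borel_measurable (A \<Otimes>\<^sub>M borel_of cemetery_topology)"
  proof (rule measurable_If)
    show "(\<lambda>p. case_prod f (fst p, g (snd p))) \<in> borel_measurable (A \<Otimes>\<^sub>M borel_of cemetery_topology)"
      by (rule measurable_compose[OF _ f]) (intro measurable_Pair measurable_fst measurable_compose[OF measurable_snd g])
  next
    have "snd -` {None} \<inter> space (A \<Otimes>\<^sub>M borel_of cemetery_topology) \<in> sets (A \<Otimes>\<^sub>M borel_of cemetery_topology)"
      by (rule measurable_sets[OF measurable_snd none])
    then show "{p \<in> space (A \<Otimes>\<^sub>M borel_of cemetery_topology). snd p = None} \<in> sets (A \<Otimes>\<^sub>M borel_of cemetery_topology)"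
      by (simp add: vimage_def Collect_conj_eq Int_commute)
  qed simp
  also have "(\<lambda>p. if snd p = None then 0 else case_prod f (fst p, g (snd p))) = (\<lambda>(i, z). case_option 0 (f i) z)"
    by (auto simp: fun_eq_iff g_def split: option.split)
  finally show ?thesis .
qed

lemma borel_measurable_case_option_section:
  fixes f :: "'a::topological_space \<Rightarrow> real"
  assumes "f \<in> borel_measurable borel"
  shows "case_option 0 f \<in> borel_measurable (borel_of cemetery_topology)"
proof -
  have "case_prod (\<lambda>_ :: unit. f) \<in> borel_measurable (count_space UNIV \<Otimes>\<^sub>M borel)"
    using measurable_compose[OF measurable_snd assms] by (simp add: case_prod_beta')
  from measurable_compose[OF measurable_Pair1' borel_measurable_case_option[OF this], of "()"]
  show ?thesis by simp
qed

context symmetric_borel_right_process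
begin

lemma transition_semigroup_eq:
  assumes "0 \<le> s" "f \<in> borel_measurable borel"
  shows "transition_semigroup \<xi> \<P> s f x = (\<integral>z. case_option 0 f z \<partial>transition_kernel s (Some x))"
  unfolding transition_semigroup_def
  using assms by (subst integral_transition_kernel) (auto intro: borel_measurable_case_option_section)

text \<open>Started at the cemetery, the process stays there; so an extended function satisfies the mild equation
  there as well, trivially.\<close>

lemma integral_transition_kernel_cemetery:
  fixes g :: "'a option \<Rightarrow> real"
  assumes s: "0 \<le> s" and g: "g \<in> borel_measurable (borel_of cemetery_topology)"
  shows "(\<integral>z. g z \<partial>transition_kernel s None) = g None"
proof -
  interpret prob_space "\<P> None" by (rule prob_space_P) simp
  have "(\<integral>z. g z \<partial>transition_kernel s None) = (\<integral>\<omega>. g (\<xi> s \<omega>) \<partial>\<P> None)"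
    using s g by (subst integral_transition_kernel) auto
  also have "\<dots> = (\<integral>\<omega>. g None \<partial>\<P> None)"
  proof (rule integral_cong_AE)
    show "AE \<omega> in \<P> None. g (\<xi> s \<omega>) = g None"
      using normal[of None, simplified] AE_space[of "\<P> None"]
    proof eventually_elim
      case (elim \<omega>)
      then have "\<xi> s \<omega> = None" using absorbing[of \<omega> 0 s] s by (simp add: space_P)
      then show ?case by simp
    qed
  qed (use measurable_compose[OF measurable_process[of None, OF _ s] g] in auto)
  also have "\<dots> = g None" by (simp add: prob_space)
  finally show ?thesis .
qed

text \<open>The extension by \<open>0\<close> turns the mild equation on \<open>E\<close> into one for the Markov kernels on
  \<open>E \<union> {\<partial>}\<close>, to which \<open>mild_solution_le\<close> applies; at \<open>\<partial>\<close> the comparison of the mechanisms reads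
  \<open>\<psi> 0 \<le> 0\<close>. The bound \<open>c\<close> depends on neither \<open>f\<close> nor \<open>x\<close>.\<close>

lemma log_laplace_le:
  assumes bm: "branching_mechanism \<beta> \<alpha> \<pi>"
    and mild: "mild_solution (transition_semigroup \<xi> \<P>) (\<lambda>x. branching_fun (\<beta> x) (\<alpha> x) (\<pi> x)) f u"
    and f: "f \<in> nonneg_bounded_borel"
    and \<psi>: "osgood_function \<psi> p c0"
    and ge: "\<And>x l. 0 \<le> l \<Longrightarrow> \<psi> l \<le> branching_fun (\<beta> x) (\<alpha> x) (\<pi> x) l"
    and t: "0 \<le> t" and c: "c0 \<le> c" "osgood_function.blow_up_time \<psi> c < t / 2"
  shows "u t x \<le> c"
proof -
  interpret bm: branching_mechanism \<beta> \<alpha> \<pi> by fact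
  let ?C = "borel_of cemetery_topology :: 'a option measure"
  have um: "(\<lambda>(t, x). u t x) \<in> borel_measurable (restrict_space borel {0..} \<Otimes>\<^sub>M borel)"
    and u0: "\<And>r y. 0 \<le> r \<Longrightarrow> 0 \<le> u r y"
    and ueq: "\<And>r y. 0 \<le> r \<Longrightarrow> u r y = transition_semigroup \<xi> \<P> r f y -
        (LBINT s:{0..r}. transition_semigroup \<xi> \<P> s (\<lambda>x. bm.mechanism x (u (r - s) x)) y)"
    using mild by (auto simp: mild_solution_def)
  obtain A where A: "\<And>r y. 0 \<le> r \<Longrightarrow> r \<le> t \<Longrightarrow> u r y \<le> A"
    using mild t by (fastforce simp: mild_solution_def)
  \<comment> \<open>only times in \<open>[0, t]\<close> are used; clipping keeps the integrand bounded and defined on the whole line\<close>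
  define clip where "clip r = max 0 (min t r)" for r :: real
  have clip: "0 \<le> clip r" "clip r \<le> t" for r using t by (auto simp: clip_def)
  have clip_id: "clip r = r" if "0 \<le> r" "r \<le> t" for r using that by (simp add: clip_def)
  obtain B where B: "\<And>x l. 0 \<le> l \<Longrightarrow> l \<le> A \<Longrightarrow> \<bar>bm.mechanism x l\<bar> \<le> B"
    using bm.mechanism_locally_bounded by blast
  have um': "(\<lambda>(r, y). u (clip r) y) \<in> borel_measurable (borel \<Otimes>\<^sub>M borel)"
  proof -
    have "(\<lambda>p. (clip (fst p), snd p)) \<in> measurable (borel \<Otimes>\<^sub>M borel) (restrict_space borel {0..} \<Otimes>\<^sub>M (borel :: 'a measure))"
      by (intro measurable_Pair measurable_restrict_space2) (auto simp: clip_def)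
    from measurable_compose[OF this um] show ?thesis by (simp add: case_prod_beta')
  qed
  define \<phi> where "\<phi> r y = bm.mechanism y (u (clip r) y)" for r y
  have \<phi>m: "case_prod \<phi> \<in> borel_measurable (borel \<Otimes>\<^sub>M borel)"
  proof -
    have "(\<lambda>p. (u (clip (fst p)) (snd p), snd p)) \<in> measurable (borel \<Otimes>\<^sub>M borel) (borel \<Otimes>\<^sub>M (borel :: 'a measure))"
      using um' by (intro measurable_Pair measurable_snd) (simp add: case_prod_beta')
    from measurable_compose[OF this bm.borel_measurable_mechanism] show ?thesis
      using u0 clip by (simp add: \<phi>_def case_prod_beta' max_absorb2)
  qed
  define \<Phi> where "\<Phi> r z = case_option 0 (\<phi> r) z" for r z
  have \<Phi>m: "case_prod \<Phi> \<in> borel_measurable (borel \<Otimes>\<^sub>M ?C)"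
    using borel_measurable_case_option[OF \<phi>m] by (simp add: \<Phi>_def[abs_def])
  have \<Phi>s: "\<Phi> r \<in> borel_measurable ?C" for r
    using measurable_compose[OF measurable_Pair1' \<Phi>m, of r] by simp
  have B0: "0 \<le> B" using B[of "u t undefined" undefined] u0[OF t] A[of t undefined] t by simp
  have \<Phi>b: "\<bar>\<Phi> r z\<bar> \<le> B" for r z
    using B u0 A clip B0 by (auto simp: \<Phi>_def \<phi>_def split: option.split)
  have fm: "f \<in> borel_measurable borel" and f0: "\<And>y. 0 \<le> f y" and "bounded (range f)"
    using f by (auto simp: nonneg_bounded_borel_def bounded_borel_def)
  then obtain D where D: "\<forall>y\<in>range f. norm y \<le> D" unfolding bounded_iff by blast
  have u_section: "u r \<in> borel_measurable borel" if "0 \<le> r" "r \<le> t" for r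
    using measurable_compose[OF measurable_Pair1' um', of r] that by (simp add: clip_id)
  have Fm: "case_option 0 f \<in> borel_measurable ?C"
    by (rule borel_measurable_case_option_section[OF fm])
  have "case_option 0 (u t) (Some x) \<le> c"
  proof (rule transition.mild_solution_le[where u="\<lambda>r. case_option 0 (u r)" and f="case_option 0 f" and C="\<bar>D\<bar>" and A="\<bar>A\<bar>",
        OF \<psi> \<Phi>m \<Phi>b Fm _ _ _ _ _ _ _ t c])
    show "\<bar>case_option 0 f z\<bar> \<le> \<bar>D\<bar>" for z
      using D by (auto split: option.split intro: order_trans)
    fix r assume r: "0 \<le> r" "r \<le> t"
    show "case_option 0 (u r) \<in> borel_measurable ?C"
      by (rule borel_measurable_case_option_section[OF u_section[OF r]])
    fix z
    show "0 \<le> case_option 0 (u r) z" using u0 r by (auto split: option.split)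
    show "case_option 0 (u r) z \<le> \<bar>A\<bar>" using order_trans[OF A[OF r] abs_ge_self] by (auto split: option.split)
    show "\<psi> (case_option 0 (u r) z) \<le> \<Phi> r z"
      using ge[of "u r _"] u0[OF r(1)] osgood_function.zero[OF \<psi>] r
      by (auto simp: \<Phi>_def \<phi>_def clip_id split: option.split)
    show "case_option 0 (u r) z = (\<integral>x. case_option 0 f x \<partial>transition_kernel r z) -
        (LBINT s:{0..r}. \<integral>x. \<Phi> (r - s) x \<partial>transition_kernel s z)"
    proof (cases z)
      case None
      have "(LBINT s:{0..r}. \<integral>x. \<Phi> (r - s) x \<partial>transition_kernel s z) = (LBINT s:{0..r}. 0)"
        using None integral_transition_kernel_cemetery[OF _ \<Phi>s]
        by (intro set_lebesgue_integral_cong) (auto simp: \<Phi>_def)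
      then show ?thesis
        using None integral_transition_kernel_cemetery[OF r(1) Fm] by (simp add: set_lebesgue_integral_def)
    next
      case (Some y)
      have "(LBINT s:{0..r}. transition_semigroup \<xi> \<P> s (\<lambda>x. bm.mechanism x (u (r - s) x)) y)
          = (LBINT s:{0..r}. \<integral>x. \<Phi> (r - s) x \<partial>transition_kernel s z)"
      proof (intro set_lebesgue_integral_cong allI impI)
        fix s assume s: "s \<in> {0..r}"
        have eq: "(\<lambda>x. bm.mechanism x (u (r - s) x)) = \<phi> (r - s)"
          using s r by (simp add: \<phi>_def[abs_def] clip_id)
        have "\<phi> (r - s) \<in> borel_measurable borel"
          using measurable_compose[OF measurable_Pair1' \<phi>m, of "r - s"] by simp
        then show "transition_semigroup \<xi> \<P> s (\<lambda>x. bm.mechanism x (u (r - s) x)) y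
            = (\<integral>x. \<Phi> (r - s) x \<partial>transition_kernel s z)"
          unfolding eq using s Some by (simp add: transition_semigroup_eq \<Phi>_def[abs_def])
      qed simp
      then show ?thesis
        using ueq[OF r(1), of y] Some transition_semigroup_eq[OF r(1) fm] by simp
    qed
  qed simp
  then show ?thesis by simp
qed

end

lemma continuous_map_total_mass:
  "continuous_map weak_topology euclideanreal (\<lambda>\<mu> :: 'a::topological_space measure. measure \<mu> UNIV)"
proof -
  have int: "(\<integral>x. 1 \<partial>\<mu>) = measure \<mu> UNIV" if "\<mu> \<in> finite_measures" for \<mu> :: "'a measure"
    using that sets_eq_imp_space_eq[of \<mu> borel] by (simp add: finite_measures_def)
  have "openin weak_topology {\<mu> :: 'a measure. \<mu> \<in> finite_measures \<and> measure \<mu> UNIV \<in> U}" if "open U" for U :: "real set"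
  proof -
    have eq: "{\<mu> :: 'a measure. \<mu> \<in> finite_measures \<and> measure \<mu> UNIV \<in> U}
        = {\<mu> \<in> finite_measures. (\<integral>x. 1 \<partial>\<mu>) \<in> U}"
      by (intro Collect_cong conj_cong refl) (simp only: int)
    show ?thesis
      unfolding weak_topology_def eq using that
      by (intro topology_generated_by_Basis CollectI exI[of _ "\<lambda>_. 1"] exI[of _ U] conjI refl)
        (auto simp: image_constant_conv)
  qed
  then show ?thesis by (auto simp: continuous_map_def)
qed

lemma total_mass_eq_0_iff:
  assumes "\<mu> \<in> finite_measures"
  shows "measure \<mu> UNIV = 0 \<longleftrightarrow> \<mu> = null_measure borel"
proof
  interpret finite_measure \<mu> using assms by (simp add: finite_measures_def)
  have sets: "sets \<mu> = sets borel" using assms by (simp add: finite_measures_def)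
  assume "measure \<mu> UNIV = 0"
  then have "emeasure \<mu> UNIV = 0" by (simp add: emeasure_eq_measure)
  then have "emeasure \<mu> B = 0" for B
    using emeasure_mono[of B UNIV \<mu>] sets sets.top[of "borel :: 'a measure"] by simp
  then show "\<mu> = null_measure borel" by (intro measure_eqI) (auto simp: sets)
qed simp

text \<open>Let \<open>k \<rightarrow> \<infinity>\<close> in \<open>P[exp (- k \<langle>1, X\<^sub>t\<rangle>)] = exp (- V\<^sub>t k(x)) \<ge> exp (- c)\<close>: the integrand tends to the
  indicator of \<open>\<langle>1, X\<^sub>t\<rangle> = 0\<close>.\<close>

lemma (in superprocess) extinction_probability_ge:
  assumes t: "0 \<le> t" and V: "\<And>k. V t (\<lambda>_. real k) x \<le> c"
  shows "exp (- c) \<le> measure (Q (return borel x)) {\<omega> \<in> space N. X t \<omega> = null_measure borel}"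
proof -
  have x: "return borel x \<in> finite_measures"
    by (simp add: finite_measures_def prob_space_return prob_space.finite_measure)
  then have x': "return borel x \<in> topspace weak_topology" by simp
  interpret prob_space "Q (return borel x)" by (rule prob_space_P[OF x'])
  let ?Q = "Q (return borel x)" and ?Z = "{\<omega> \<in> space N. X t \<omega> = null_measure borel}"
  define m where "m \<omega> = measure (X t \<omega>) UNIV" for \<omega>
  note Xm = measurable_process[OF x' t]
  have mm[measurable]: "m \<in> borel_measurable ?Q"
    unfolding m_def
    by (rule measurable_compose[OF Xm borel_measurable_continuous_map[OF continuous_map_total_mass]])
  have sp: "space ?Q = space N" by (rule space_P[OF x'])
  have fin: "X t \<omega> \<in> finite_measures" if "\<omega> \<in> space N" for \<omega>
    using measurable_space[OF Xm] that by (simp add: sp)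
  have Z: "?Z = {\<omega> \<in> space ?Q. m \<omega> = 0}"
    using total_mass_eq_0_iff[OF fin] by (auto simp: m_def sp)
  have Zs: "?Z \<in> sets ?Q" unfolding Z by measurable
  have "exp (- c) \<le> (\<integral>\<omega>. exp (- (real k * m \<omega>)) \<partial>?Q)" for k
  proof -
    have k: "(\<lambda>_. real k) \<in> nonneg_bounded_borel"
      by (auto simp: nonneg_bounded_borel_def bounded_borel_def image_constant_conv)
    have Vk: "V t (\<lambda>_. real k) \<in> borel_measurable borel"
    proof -
      have "(\<lambda>(t, x). V t (\<lambda>_. real k) x) \<in> borel_measurable (restrict_space borel {0..} \<Otimes>\<^sub>M borel)"
        using log_laplace k by (auto simp: log_laplace_semigroup_def mild_solution_def)
      from measurable_compose[OF measurable_Pair1' this, of t] show ?thesis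
        using t by (simp add: space_restrict_space)
    qed
    have "exp (- c) \<le> exp (- V t (\<lambda>_. real k) x)" using V[of k] by simp
    also have "\<dots> = (\<integral>\<omega>. exp (- (\<integral>x. real k \<partial>X t \<omega>)) \<partial>?Q)"
      using laplace_functional[OF x t k] integral_return[OF _ Vk, of x] by simp
    also have "\<dots> = (\<integral>\<omega>. exp (- (real k * m \<omega>)) \<partial>?Q)"
    proof (rule Bochner_Integration.integral_cong[OF refl])
      fix \<omega> assume "\<omega> \<in> space ?Q"
      then have "sets (X t \<omega>) = sets borel" using fin by (simp add: sp finite_measures_def)
      then have "space (X t \<omega>) = UNIV" using sets_eq_imp_space_eq by fastforce
      then show "exp (- (\<integral>x. real k \<partial>X t \<omega>)) = exp (- (real k * m \<omega>))" by (simp add: m_def mult.commute)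
    qed
    finally show ?thesis .
  qed
  moreover have "(\<lambda>k. \<integral>\<omega>. exp (- (real k * m \<omega>)) \<partial>?Q) \<longlonglongrightarrow> (\<integral>\<omega>. indicator ?Z \<omega> \<partial>?Q)"
  proof (rule integral_dominated_convergence[where w="\<lambda>_. 1"])
    show "AE \<omega> in ?Q. (\<lambda>k. exp (- (real k * m \<omega>))) \<longlonglongrightarrow> indicator ?Z \<omega>"
    proof (rule AE_I2)
      fix \<omega> assume \<omega>: "\<omega> \<in> space ?Q"
      show "(\<lambda>k. exp (- (real k * m \<omega>))) \<longlonglongrightarrow> indicator ?Z \<omega>"
      proof (cases "m \<omega> = 0")
        case False
        then have "0 < m \<omega>" by (simp add: m_def order_less_le)
        then have "exp (- m \<omega>) < 1" by simp
        then have "(\<lambda>k. exp (- m \<omega>) ^ k) \<longlonglongrightarrow> 0" by (intro LIMSEQ_power_zero) simp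
        then show ?thesis using False by (simp add: Z exp_of_nat_mult[symmetric])
      qed (use \<omega> in \<open>simp add: Z\<close>)
    qed
    show "AE \<omega> in ?Q. norm (exp (- (real k * m \<omega>))) \<le> 1" for k
      by (rule AE_I2) (simp add: m_def)
    show "indicator ?Z \<in> borel_measurable ?Q" using Zs by simp
  qed auto
  ultimately have "exp (- c) \<le> (\<integral>\<omega>. indicator ?Z \<omega> \<partial>?Q)"
    by (intro LIMSEQ_le_const) auto
  also have "\<dots> = measure ?Q ?Z" using Zs by simp
  finally show ?thesis .
qed

text \<open>The jump part of the representation is nonnegative, so \<open>k \<Lambda>\<^sub>t(x, E) \<le> V\<^sub>t k(x) \<le> c\<close> for every \<open>k\<close>.\<close>

lemma (in canonical_representation) Lambda_null:
  assumes t: "0 < t" and V: "\<And>k. V t (\<lambda>_. real k) x \<le> c"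
  shows "emeasure (\<Lambda> t x) UNIV = 0"
proof -
  have bk: "kernel borel borel (\<Lambda> t)" "(SUP x. emeasure (\<Lambda> t x) UNIV) < \<infinity>"
    using bounded_Lambda[OF t] by (auto simp: bounded_kernel_def)
  have sets: "sets (\<Lambda> t x) = sets borel" using bk(1) by (simp add: kernel_def)
  have space: "space (\<Lambda> t x) = UNIV" using sets_eq_imp_space_eq[OF sets] by simp
  have "emeasure (\<Lambda> t x) UNIV < \<infinity>"
    using bk(2) by (rule le_less_trans[rotated]) (rule SUP_upper, simp)
  then have fin: "emeasure (\<Lambda> t x) UNIV = ennreal (measure (\<Lambda> t x) UNIV)"
    by (intro emeasure_eq_ennreal_measure) simp
  have le: "real k * measure (\<Lambda> t x) UNIV \<le> c" for k
  proof -
    have k: "(\<lambda>_. real k) \<in> nonneg_bounded_borel"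
      by (auto simp: nonneg_bounded_borel_def bounded_borel_def image_constant_conv)
    have "0 \<le> (\<integral>\<nu>. (1 - exp (- (\<integral>y. real k \<partial>\<nu>))) \<partial>L t x)"
      by (intro integral_nonneg_AE AE_I2) (simp add: measure_nonneg)
    then have "(\<integral>y. real k \<partial>\<Lambda> t x) \<le> V t (\<lambda>_. real k) x"
      using representation[OF t k, of x] by linarith
    then show ?thesis using V[of k] by (simp add: space mult.commute)
  qed
  have "measure (\<Lambda> t x) UNIV = 0"
  proof (rule ccontr)
    assume "measure (\<Lambda> t x) UNIV \<noteq> 0"
    then have pos: "0 < measure (\<Lambda> t x) UNIV" by (simp add: order_less_le)
    obtain k where "c < real k * measure (\<Lambda> t x) UNIV"
      using reals_Archimedean3[OF pos] by blast
    then show False using le[of k] by simp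
  qed
  then show ?thesis using fin by simp
qed

theorem proposition2p5:
  fixes \<xi> :: "real \<Rightarrow> 'w \<Rightarrow> 'a::topological_space option"
    and X :: "real \<Rightarrow> 'v \<Rightarrow> 'a measure"
    and \<beta> \<alpha> :: "'a \<Rightarrow> real" and \<pi> :: "'a \<Rightarrow> real measure"
    and b a :: real and \<eta> :: "real measure"
  assumes "luzin_space (euclidean :: 'a topology)"
    and "symmetric_borel_right_process M F \<xi> \<P> m"
    and "branching_mechanism \<beta> \<alpha> \<pi>"
    and "superprocess N G X Q (transition_semigroup \<xi> \<P>)
           (\<lambda>x. branching_fun (\<beta> x) (\<alpha> x) (\<pi> x)) V"
    and "canonical_representation V \<Lambda> L"
    and "0 \<le> a"
    and "sets \<eta> = sets positive_borel"
    and "(\<integral>\<^sup>+y. ennreal (min y (y\<^sup>2)) \<partial>\<eta>) < \<infinity>"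
    and "filterlim (branching_fun b a \<eta>) at_top at_top"
    and "\<exists>c>0. set_integrable lborel {c..} (\<lambda>l. 1 / branching_fun b a \<eta> l)"
    and "\<forall>x. \<forall>l\<ge>0. branching_fun (\<beta> x) (\<alpha> x) (\<pi> x) l \<ge> branching_fun b a \<eta> l"
  shows "(\<forall>x. \<forall>t>0. measure (Q (return borel x)) {\<omega> \<in> space N. X t \<omega> = null_measure borel} > 0) \<and>
         E0 \<Lambda> = UNIV"
proof -
  interpret process: symmetric_borel_right_process M F \<xi> \<P> m by fact
  interpret superprocess N G X Q "transition_semigroup \<xi> \<P>" "\<lambda>x. branching_fun (\<beta> x) (\<alpha> x) (\<pi> x)" V
    by fact
  interpret canonical_representation V \<Lambda> L by fact
  interpret jump_measure \<eta> by unfold_locales fact+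
  obtain c0 where "osgood_function (branching_fun b a \<eta>) (branching_slope b a \<eta>) c0"
    using assms(10) osgood_branching_fun[OF assms(6,9)] by blast
  then interpret osgood_function "branching_fun b a \<eta>" "branching_slope b a \<eta>" c0 .
  have bound: "\<exists>c. \<forall>x k. V t (\<lambda>_. real k) x \<le> c" if t: "0 < t" for t
  proof -
    have "eventually (\<lambda>c. blow_up_time c < t / 2) at_top"
      using order_tendstoD(2)[OF blow_up_time_tendsto_0, of "t / 2"] t by simp
    then have "eventually (\<lambda>c. c0 \<le> c \<and> blow_up_time c < t / 2) at_top"
      using eventually_ge_at_top[of c0] by eventually_elim simp
    then obtain c where c: "c0 \<le> c" "blow_up_time c < t / 2"
      by (auto simp: eventually_at_top_linorder)
    have "V t (\<lambda>_. real k) x \<le> c" for x k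
    proof (rule process.log_laplace_le[OF assms(3) _ _ osgood_function_axioms _ _ c])
      show k: "(\<lambda>_. real k) \<in> nonneg_bounded_borel"
        by (auto simp: nonneg_bounded_borel_def bounded_borel_def image_constant_conv)
      then show "mild_solution (transition_semigroup \<xi> \<P>) (\<lambda>x. branching_fun (\<beta> x) (\<alpha> x) (\<pi> x))
          (\<lambda>_. real k) (\<lambda>t. V t (\<lambda>_. real k))"
        using log_laplace unfolding log_laplace_semigroup_def by blast
    qed (use assms(11) t in auto)
    then show ?thesis by blast
  qed
  have "0 < measure (Q (return borel x)) {\<omega> \<in> space N. X t \<omega> = null_measure borel}" if t: "0 < t" for x t
  proof -
    obtain c where "\<And>x k. V t (\<lambda>_. real k) x \<le> c" using bound[OF t] by blast
    then show ?thesis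
      using extinction_probability_ge[of t x c] t exp_gt_zero[of "- c"] by (smt (verit))
  qed
  moreover have "emeasure (\<Lambda> t x) UNIV = 0" if t: "0 < t" for x t
    using bound[OF t] Lambda_null[OF t] by blast
  ultimately show ?thesis by (auto simp: E0_def)
qed

end
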